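(* Let $n,N\ge1$. Let $S_N(n)$ be the set of permutations $\sigma\in S(n)$ having no decreasing subsequence of length $N+1$ (i.e. there are no indices $i_1<\dots<i_{N+1}$ with $\sigma(i_1)>\dots>\sigma(i_{N+1})$), and let $\mathsf G$ be the $|S_N(n)|\times|S_N(n)|$ matrix $\mathsf G=(N^{\#(\sigma\tau^{-1})})_{\sigma,\tau\in S_N(n)}$, where $\#(\rho)$ is the number of cycles (including fixed points) of $\rho$. Then $\mathsf G$ is invertible, and for all functions $i,j,i',j':\{1,\dots,n\}\to\{1,\dots,N\}$, $$\Big\langle \prod_{k=1}^n u_{i(k)j(k)}\overline{u_{i'(k)j'(k)}}\Big\rangle_N=\sum_{\sigma,\tau\in S_N(n)}[i=i'\circ\sigma]\,[j=j'\circ\tau]\,(\mathsf G^{-1})_{\sigma,\tau}.$$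
   Context: $U=(u_{ab})$ is an $N\times N$ random unitary matrix distributed according to Haar probability measure on $\mathcal U(N)$ and $\langle\cdot\rangle_N$ denotes expectation. $S(n)$ is the symmetric group on $\{1,\dots,n\}$, with product given by composition. $[P]$ is $1$ if the statement $P$ is true and $0$ otherwise; $i'\circ\sigma$ is the function $k\mapsto i'(\sigma(k))$. *)

theory Defs
  imports "HOL-Probability.Probability" "HOL-Combinatorics.Orbits"
begin

definition unitary_group :: "(complex ^ 'N ^ 'N) set" where
  "unitary_group =
     {U. U ** transpose (map_matrix cnj U) = mat 1 \<and> transpose (map_matrix cnj U) ** U = mat 1}"

text \<open>A Haar probability measure is a left-invariant Borel probability measure on the (compact)
  unitary group. The equation for \<^term>\<open>sets M\<close> also forces the underlying space of \<^term>\<open>M\<close>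
  to be the unitary group.\<close>

definition haar_unitary :: "(complex ^ 'N ^ 'N) measure \<Rightarrow> bool" where
  "haar_unitary M \<longleftrightarrow>
     prob_space M \<and>
     sets M = sets (restrict_space borel unitary_group) \<and>
     (\<forall>V\<in>unitary_group. distr M M (\<lambda>U. V ** U) = M)"

definition perms_no_decreasing :: "nat \<Rightarrow> nat \<Rightarrow> (nat \<Rightarrow> nat) set" where
  "perms_no_decreasing N n =
     {\<sigma>. \<sigma> permutes {1..n} \<and>
         \<not> (\<exists>s. s ` {1..N + 1} \<subseteq> {1..n} \<and> strict_mono_on {1..N + 1} s \<and>
                strict_antimono_on {1..N + 1} (\<sigma> \<circ> s))}"

text \<open>Orbits are those of points of \<open>{1..n}\<close> only: permutations are functions on all of
  \<^typ>\<open>nat\<close>, and the fixed points outside \<open>{1..n}\<close> must not be counted.\<close>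

definition num_cycles :: "nat \<Rightarrow> (nat \<Rightarrow> nat) \<Rightarrow> nat" where
  "num_cycles n \<rho> = card (orbit \<rho> ` {1..n})"

definition gram_matrix :: "nat \<Rightarrow> nat \<Rightarrow> (nat \<Rightarrow> nat) \<Rightarrow> (nat \<Rightarrow> nat) \<Rightarrow> complex" where
  "gram_matrix N n \<sigma> \<tau> = of_nat N ^ num_cycles n (\<sigma> \<circ> inv \<tau>)"

text \<open>Square matrices with rows and columns indexed by a finite set \<open>S\<close> are binary functions of which
  only the values on \<open>S \<times> S\<close> matter. Below, \<open>inverse_on S A\<close> is determined only
  on \<open>S \<times> S\<close> (uniquely so, if \<open>A\<close> is invertible).\<close>

definition is_inverse_on ::
  "'a set \<Rightarrow> ('a \<Rightarrow> 'a \<Rightarrow> complex) \<Rightarrow> ('a \<Rightarrow> 'a \<Rightarrow> complex) \<Rightarrow> bool" where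
  "is_inverse_on S A B \<longleftrightarrow>
     (\<forall>x\<in>S. \<forall>y\<in>S. (\<Sum>z\<in>S. A x z * B z y) = of_bool (x = y) \<and>
                  (\<Sum>z\<in>S. B x z * A z y) = of_bool (x = y))"

definition invertible_on :: "'a set \<Rightarrow> ('a \<Rightarrow> 'a \<Rightarrow> complex) \<Rightarrow> bool" where
  "invertible_on S A \<longleftrightarrow> (\<exists>B. is_inverse_on S A B)"

definition inverse_on :: "'a set \<Rightarrow> ('a \<Rightarrow> 'a \<Rightarrow> complex) \<Rightarrow> 'a \<Rightarrow> 'a \<Rightarrow> complex" where
  "inverse_on S A = (SOME B. is_inverse_on S A B)"

end

theory Submission
  imports Defs
begin

text \<open>
  View \<open>v\<^sub>\<sigma>(i, i') = [i = i' \<circ> \<sigma>]\<close> as an operator on the \<open>n\<close>-th tensor power of \<open>\<complex>\<^sup>N\<close>; the Gram matrix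
  of these tensors is \<open>N\<^bsup>#(\<sigma>\<tau>\<inverse>)\<^esup>\<close>. Antisymmetrizing over \<open>N + 1\<close> positions gives zero, and
  straightening along decreasing subsequences shows that the \<open>v\<^sub>\<sigma>\<close> without decreasing subsequence of
  length \<open>N + 1\<close> span all of them. They are independent, since such a \<open>\<sigma>\<close> is increasing on the classes
  of an \<open>N\<close>-colouring, and evaluating at the colouring is unitriangular in the lexicographic order.
  For fixed \<open>j, j'\<close> the moments form an operator that commutes with all \<open>U\<^bsup>\<otimes>n\<^esup>\<close> by left invariance, so by
  Schur--Weyl duality it is a combination of the \<open>v\<^sub>\<sigma>\<close>. Its inner products with the \<open>v\<^sub>\<tau>\<close> are
  \<open>v\<^sub>\<tau>(j, j')\<close> by unitarity, and inverting the Gram matrix yields the coefficients.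
\<close>

section \<open>Permutations without long decreasing subsequences\<close>

text \<open>For n > N the relations coming from antisymmetrizers on N + 1 positions are nontrivial,
  so the Gram matrix over all of S(n) is singular; this is why the index set has to be cut down to a
  basis. Spanning and independence pick out the same basis because both are governed by the
  lexicographic order: a long decreasing subsequence can always be rearranged into something
  smaller, while its absence makes \<open>\<sigma>\<close> the smallest permutation compatible with
  some colouring.

  The bridge from unitary matrices to arbitrary operators is infinitesimal. Commuting with all
  tensor powers of unitaries passes by differentiation to the derivations that put one matrix Y into
  a single slot and sum over the slots; products of such derivations produce every symmetrized
  tensor, and these span all kernels that are unchanged when both arguments are permuted together.
  The inverse Gram matrix is then used twice: as the coefficients in the final formula, and before
  that inside an explicit projection onto the span of the permutations, which is what Schur--Weyl
  duality is extracted from.\<close>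

definition lex_less :: "(nat \<Rightarrow> nat) \<Rightarrow> (nat \<Rightarrow> nat) \<Rightarrow> bool" where
  "lex_less \<rho> \<sigma> \<longleftrightarrow> (\<exists>k. (\<forall>l<k. \<rho> l = \<sigma> l) \<and> \<rho> k < \<sigma> k)"

lemma lex_less_trans:
  assumes "lex_less \<rho> \<sigma>" and "lex_less \<sigma> \<tau>"
  shows "lex_less \<rho> \<tau>"
proof -
  from assms obtain k m where k: "\<forall>l<k. \<rho> l = \<sigma> l" "\<rho> k < \<sigma> k"
    and m: "\<forall>l<m. \<sigma> l = \<tau> l" "\<sigma> m < \<tau> m"
    unfolding lex_less_def by blast
  show ?thesis
    unfolding lex_less_def
    by (rule exI[of _ "min k m"], use k m in \<open>cases k m rule: linorder_cases\<close>) auto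
qed

lemma lex_less_irrefl: "\<not> lex_less \<sigma> \<sigma>"
  by (auto simp: lex_less_def)

text \<open>On all functions the order has infinite descending chains; on a finite set, transitivity
  and irreflexivity make it well-founded in both directions. Spanning is proved along the order,
  independence along its converse.\<close>

lemma wf_lex_less_on:
  assumes "finite A"
  shows "wf {(\<rho>, \<sigma>). \<rho> \<in> A \<and> \<sigma> \<in> A \<and> lex_less \<rho> \<sigma>}"
    and "wf {(\<sigma>, \<rho>). \<rho> \<in> A \<and> \<sigma> \<in> A \<and> lex_less \<rho> \<sigma>}"
proof -
  let ?r = "{(\<rho>, \<sigma>). \<rho> \<in> A \<and> \<sigma> \<in> A \<and> lex_less \<rho> \<sigma>}"
  have fin: "finite ?r"
    by (rule finite_subset[of _ "A \<times> A"]) (use assms in auto)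
  have "trans ?r"
    by (auto intro!: transI intro: lex_less_trans)
  then have ac: "acyclic ?r"
    by (auto simp: acyclic_def lex_less_irrefl)
  show "wf ?r"
    by (rule finite_acyclic_wf[OF fin ac])
  have "wf (?r\<inverse>)"
    by (rule finite_acyclic_wf_converse[OF fin ac])
  moreover have "?r\<inverse> = {(\<sigma>, \<rho>). \<rho> \<in> A \<and> \<sigma> \<in> A \<and> lex_less \<rho> \<sigma>}"
    by auto
  ultimately show "wf {(\<sigma>, \<rho>). \<rho> \<in> A \<and> \<sigma> \<in> A \<and> lex_less \<rho> \<sigma>}"
    by simp
qed

text \<open>At the least moved point \<open>k\<close> the value \<open>\<pi> k\<close> cannot be
  smaller: it would be a fixed point, and injectivity would force \<open>\<pi> k = k\<close>. Both
  lexicographic comparisons below are decided at this point.\<close>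

lemma inj_first_moved:
  fixes \<pi> :: "nat \<Rightarrow> nat"
  assumes "inj \<pi>" and "\<pi> \<noteq> id"
  obtains k where "k < \<pi> k" and "\<And>l. l < k \<Longrightarrow> \<pi> l = l"
proof -
  define k where "k = (LEAST k. \<pi> k \<noteq> k)"
  from \<open>\<pi> \<noteq> id\<close> have "\<exists>k. \<pi> k \<noteq> k" by auto
  then have k: "\<pi> k \<noteq> k" unfolding k_def by (rule LeastI_ex)
  have below: "\<pi> l = l" if "l < k" for l
    using that not_less_Least unfolding k_def by blast
  have "\<not> \<pi> k < k"
    using below[of "\<pi> k"] k \<open>inj \<pi>\<close> by (auto dest: injD)
  with k below show thesis by (intro that[of k]) auto
qed

text \<open>Positions are collected in a set \<open>C\<close> instead of an increasing enumeration
  \<open>s\<close>, because an antisymmetrizer acts on a set and chains are extended by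
  \<open>insert\<close>.\<close>

lemma perms_no_decreasing_iff:
  "\<sigma> \<in> perms_no_decreasing N n \<longleftrightarrow>
     \<sigma> permutes {1..n} \<and>
     \<not> (\<exists>C \<subseteq> {1..n}. card C = N + 1 \<and> (\<forall>a\<in>C. \<forall>b\<in>C. a < b \<longrightarrow> \<sigma> b < \<sigma> a))"
    (is "_ \<longleftrightarrow> _ \<and> \<not> ?chain")
proof -
  let ?seq = "\<exists>s. s ` {1..N + 1} \<subseteq> {1..n} \<and> strict_mono_on {1..N + 1} s \<and>
                strict_antimono_on {1..N + 1} (\<sigma> \<circ> s)"
  have "?seq \<longleftrightarrow> ?chain"
  proof
    assume ?seq
    then obtain s where s: "s ` {1..N + 1} \<subseteq> {1..n}" "strict_mono_on {1..N + 1} s"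
      "strict_antimono_on {1..N + 1} (\<sigma> \<circ> s)" by blast
    have inj: "inj_on s {1..N + 1}"
      using s(2) by (rule strict_mono_on_imp_inj_on)
    show ?chain
    proof (intro exI[of _ "s ` {1..N + 1}"] conjI ballI impI)
      show "card (s ` {1..N + 1}) = N + 1" using card_image[OF inj] by simp
      fix a b assume "a \<in> s ` {1..N + 1}" "b \<in> s ` {1..N + 1}" "a < b"
      then obtain p q where pq: "p \<in> {1..N + 1}" "q \<in> {1..N + 1}" "a = s p" "b = s q" by blast
      have "p < q"
        using \<open>a < b\<close> pq s(2) by (metis strict_mono_on_less)
      then show "\<sigma> b < \<sigma> a"
        using monotone_onD[OF s(3) pq(1,2)] pq by simp
    qed (use s in auto)
  next
    assume ?chain
    then obtain C where C: "C \<subseteq> {1..n}" "card C = N + 1"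
      "\<forall>a\<in>C. \<forall>b\<in>C. a < b \<longrightarrow> \<sigma> b < \<sigma> a" by blast
    have finC: "finite C" using C(1) finite_subset by blast
    \<comment> \<open>The enumeration is indexed from 1, list positions from 0.\<close>
    define s where "s = (\<lambda>k. sorted_list_of_set C ! (k - 1))"
    have len: "length (sorted_list_of_set C) = N + 1"
      using C finC by simp
    have sw: "sorted_wrt (<) (sorted_list_of_set C)"
      using finC by simp
    have in_C: "s k \<in> C" if "k \<in> {1..N + 1}" for k
    proof -
      have "k - 1 < length (sorted_list_of_set C)" using that len by auto
      then have "s k \<in> set (sorted_list_of_set C)" unfolding s_def by (rule nth_mem)
      then show ?thesis using finC by simp
    qed
    have mono: "s k < s l" if "k \<in> {1..N + 1}" "l \<in> {1..N + 1}" "k < l" for k l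
      unfolding s_def by (rule sorted_wrt_nth_less[OF sw]) (use that len in auto)
    have "strict_mono_on {1..N + 1} s"
      by (intro monotone_onI mono)
    moreover have "strict_antimono_on {1..N + 1} (\<sigma> \<circ> s)"
      using C(3) by (auto intro!: monotone_onI simp: mono in_C)
    ultimately show ?seq using in_C C(1) by blast
  qed
  then show ?thesis unfolding perms_no_decreasing_def by (simp only: mem_Collect_eq)
qed

lemma finite_perms_no_decreasing: "finite (perms_no_decreasing N n)"
  by (rule finite_subset[OF _ finite_permutations[of "{1..n}"]])
     (auto simp: perms_no_decreasing_def)

lemma perms_no_decreasing_permutes:
  "\<sigma> \<in> perms_no_decreasing N n \<Longrightarrow> \<sigma> permutes {1..n}"
  by (simp add: perms_no_decreasing_def)

text \<open>The argument of Mirsky's theorem: a position is coloured by the length of the longest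
  decreasing subsequence ending there. If \<open>k < l\<close> had the same colour and
  \<open>\<sigma> l < \<sigma> k\<close>, appending \<open>l\<close> to a longest one ending at
  \<open>k\<close> would give \<open>l\<close> a larger colour.\<close>

lemma perms_no_decreasing_colouring:
  assumes "\<sigma> \<in> perms_no_decreasing N n"
  obtains c :: "nat \<Rightarrow> nat" where "c ` {1..n} \<subseteq> {1..N}"
    and "\<And>k l. k \<in> {1..n} \<Longrightarrow> l \<in> {1..n} \<Longrightarrow> k < l \<Longrightarrow> c k = c l \<Longrightarrow> \<sigma> k < \<sigma> l"
proof -
  \<comment> \<open>\<open>Ch k\<close> consists of the position sets of decreasing subsequences
    whose last position is \<open>k\<close>.\<close>
  define Ch where "Ch = (\<lambda>k. {C. C \<subseteq> {1..k} \<and> k \<in> C \<and> (\<forall>a\<in>C. \<forall>b\<in>C. a < b \<longrightarrow> \<sigma> b < \<sigma> a)})"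
  define c where "c = (\<lambda>k. Max (card ` Ch k))"
  have per: "\<sigma> permutes {1..n}" and none:
    "\<And>C. C \<subseteq> {1..n} \<Longrightarrow> (\<forall>a\<in>C. \<forall>b\<in>C. a < b \<longrightarrow> \<sigma> b < \<sigma> a) \<Longrightarrow> card C \<noteq> N + 1"
    using assms unfolding perms_no_decreasing_iff by blast+
  have fin: "finite (Ch k)" for k
    by (rule finite_subset[of _ "Pow {1..k}"]) (auto simp: Ch_def)
  have bound: "card C \<le> N" if "C \<in> Ch k" "k \<le> n" for C k
  proof (rule ccontr)
    assume "\<not> card C \<le> N"
    then obtain D where "D \<subseteq> C" "card D = N + 1"
      by (metis not_less_eq_eq obtain_subset_with_card_n Suc_eq_plus1)
    moreover have "D \<subseteq> {1..n}" and "\<forall>a\<in>D. \<forall>b\<in>D. a < b \<longrightarrow> \<sigma> b < \<sigma> a"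
      using \<open>D \<subseteq> C\<close> that unfolding Ch_def by (fastforce, blast)
    ultimately show False using none by blast
  qed
  have attained: "\<exists>C\<in>Ch k. c k = card C" if "k \<in> {1..n}" for k
  proof -
    have "{k} \<in> Ch k" using that by (auto simp: Ch_def)
    then have "c k \<in> card ` Ch k"
      unfolding c_def by (intro Max_in) (use fin in auto)
    then show ?thesis by auto
  qed
  show thesis
  proof (rule that[of c])
    show "c ` {1..n} \<subseteq> {1..N}"
    proof
      fix x assume "x \<in> c ` {1..n}"
      then obtain k where k: "k \<in> {1..n}" "x = c k" by blast
      then obtain C where C: "C \<in> Ch k" "c k = card C" using attained by blast
      have "card C \<noteq> 0"
        using C(1) finite_subset[of C "{1..k}"] by (auto simp: Ch_def)
      then show "x \<in> {1..N}" using bound[OF C(1)] k C by auto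
    qed
  next
    fix k l assume kl: "k \<in> {1..n}" "l \<in> {1..n}" "k < l" "c k = c l"
    obtain C where C: "C \<in> Ch k" "c k = card C" using attained[OF kl(1)] by blast
    have sub: "C \<subseteq> {1..k}" "finite C" "l \<notin> C"
      using C(1) kl(3) finite_subset[of C "{1..k}"] by (auto simp: Ch_def)
    have "\<not> \<sigma> l < \<sigma> k"
    proof
      assume less: "\<sigma> l < \<sigma> k"
      \<comment> \<open>\<open>k\<close> is the last position of \<open>C\<close> and carries its
        smallest value, so \<open>l\<close> can be appended.\<close>
      have below: "a \<le> k \<and> \<sigma> k \<le> \<sigma> a" if "a \<in> C" for a
        using C(1) that unfolding Ch_def by (cases "a = k") fastforce+
      have dec: "\<sigma> b < \<sigma> a" if "a \<in> C" "b \<in> C" "a < b" for a b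
        using C(1) that unfolding Ch_def by blast
      have "\<sigma> b < \<sigma> a" if "a \<in> insert l C" "b \<in> insert l C" "a < b" for a b
      proof (cases "b = l")
        case True
        then show ?thesis using that below[of a] less by auto
      next
        case False
        then show ?thesis using that below[of b] kl(3) dec[of a b] by auto
      qed
      moreover have "insert l C \<subseteq> {1..l}"
        using sub(1) kl(2,3) by fastforce
      ultimately have "insert l C \<in> Ch l"
        unfolding Ch_def by blast
      then have "card (insert l C) \<le> c l"
        unfolding c_def by (intro Max_ge) (use fin in auto)
      with sub C(2) kl(4) show False by simp
    qed
    moreover have "\<sigma> k \<noteq> \<sigma> l"
      using kl(3) permutes_inj[OF per] by (auto dest: injD)
    ultimately show "\<sigma> k < \<sigma> l" by simp
  qed
qed

section \<open>Permutation tensors\<close>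

text \<open>Comparing on \<open>{1..n}\<close> alone makes the value independent of what
  \<open>i\<close> does elsewhere, so linear relations between these tensors can be stated for all
  functions and not only for tuples.\<close>

definition perm_tensor ::
  "nat \<Rightarrow> (nat \<Rightarrow> nat) \<Rightarrow> (nat \<Rightarrow> 'a) \<Rightarrow> (nat \<Rightarrow> 'a) \<Rightarrow> complex" where
  "perm_tensor n \<sigma> i i' = of_bool (\<forall>k\<in>{1..n}. i k = i' (\<sigma> k))"

text \<open>Extensional functions provide one representative for every map on \<open>{1..n}\<close>.
  They index the standard basis of the tensor power, and sums over them are finite.\<close>

abbreviation tuples :: "nat \<Rightarrow> (nat \<Rightarrow> 'a) set" where
  "tuples n \<equiv> {1..n} \<rightarrow>\<^sub>E UNIV"

lemma finite_tuples: "finite (tuples n :: (nat \<Rightarrow> 'a::finite) set)"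
  by (rule finite_PiE) auto

lemma tuples_eqI:
  assumes "i \<in> tuples n" and "j \<in> tuples n" and "\<And>k. k \<in> {1..n} \<Longrightarrow> i k = j k"
  shows "i = j"
  using assms by (rule PiE_ext)

lemma tuples_comp:
  assumes "i \<in> tuples n" and "\<pi> permutes {1..n}"
  shows "i \<circ> \<pi> \<in> tuples n"
proof (rule PiE_I)
  fix k assume "k \<notin> {1..n}"
  then have "\<pi> k = k" using assms(2) by (rule permutes_not_in[rotated])
  then show "(i \<circ> \<pi>) k = undefined" using \<open>k \<notin> {1..n}\<close> assms(1) by auto
qed simp

lemma sum_tuples_comp:
  fixes f :: "(nat \<Rightarrow> 'a) \<Rightarrow> 'b::comm_monoid_add"
  assumes "\<pi> permutes {1..n}"
  shows "(\<Sum>i\<in>tuples n. f (i \<circ> \<pi>)) = (\<Sum>i\<in>tuples n. f i)"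
proof (rule sum.reindex_bij_witness[of _ "\<lambda>i. i \<circ> inv \<pi>" "\<lambda>i. i \<circ> \<pi>"])
  fix i :: "nat \<Rightarrow> 'a" assume "i \<in> tuples n"
  then show "i \<circ> \<pi> \<in> tuples n" "i \<circ> inv \<pi> \<in> tuples n"
    by (rule tuples_comp[OF _ assms], rule tuples_comp[OF _ permutes_inv[OF assms]])
  show "i \<circ> \<pi> \<circ> inv \<pi> = i" "i \<circ> inv \<pi> \<circ> \<pi> = i"
    using permutes_inv_o[OF assms] by (simp_all add: comp_assoc)
qed simp

lemma perm_tensor_on_tuples:
  assumes "i \<in> tuples n" and "i' \<in> tuples n" and "\<sigma> permutes {1..n}"
  shows "perm_tensor n \<sigma> i i' = of_bool (i = i' \<circ> \<sigma>)"
proof -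
  have "(\<forall>k\<in>{1..n}. i k = i' (\<sigma> k)) \<longleftrightarrow> i = i' \<circ> \<sigma>"
    using tuples_eqI[OF assms(1) tuples_comp[OF assms(2,3)]] by auto
  then show ?thesis unfolding perm_tensor_def by simp
qed

lemma perm_tensor_comp:
  assumes "\<pi> permutes {1..n}"
  shows "perm_tensor n \<sigma> (i \<circ> \<pi>) i' = perm_tensor n (\<sigma> \<circ> inv \<pi>) i i'"
proof -
  have "(\<forall>k\<in>{1..n}. (i \<circ> \<pi>) k = i' (\<sigma> k)) \<longleftrightarrow>
      (\<forall>k\<in>\<pi> ` {1..n}. i k = i' ((\<sigma> \<circ> inv \<pi>) k))"
    by (simp add: permutes_inverses[OF assms])
  then show ?thesis
    unfolding perm_tensor_def permutes_image[OF assms] by simp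
qed

text \<open>Pigeonhole: on \<open>N + 1\<close> positions \<open>i\<close> takes some value twice,
  at \<open>p\<close> and \<open>q\<close>. Composing with their transposition flips the sign but
  leaves the tensor unchanged, so the sum equals its own negative.\<close>

lemma antisymmetrizer_zero:
  fixes i i' :: "nat \<Rightarrow> 'N::finite"
  assumes "C \<subseteq> {1..n}" and "card C = CARD('N) + 1" and "\<sigma> permutes {1..n}"
  shows "(\<Sum>\<pi> | \<pi> permutes C. of_int (sign \<pi>) * perm_tensor n (\<sigma> \<circ> \<pi>) i i') = 0"
proof -
  have "finite C" using assms(1) finite_subset by blast
  have "\<not> inj_on i C"
    using card_inj_on_le[of i C UNIV] assms(2) by auto
  then obtain p q where pq: "p \<in> C" "q \<in> C" "p \<noteq> q" "i p = i q"
    by (auto simp: inj_on_def)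
  define t where "t = Transposition.transpose p q"
  have t: "t permutes C" unfolding t_def by (rule permutes_swap_id) (use pq in auto)
  have tn: "t permutes {1..n}" by (rule permutes_subset[OF t assms(1)])
  have it: "i \<circ> t = i"
    unfolding t_def using pq(4) by (auto simp: Transposition.transpose_def)
  have tt: "inv t = t" unfolding t_def by simp
  let ?f = "\<lambda>\<pi>. of_int (sign \<pi>) * perm_tensor n (\<sigma> \<circ> \<pi>) i i'"
  have "(\<Sum>\<pi> | \<pi> permutes C. ?f \<pi>) = (\<Sum>\<pi> | \<pi> permutes C. ?f (\<pi> \<circ> t))"
    by (rule sum_permutations_compose_right[OF t])
  also have "\<dots> = (\<Sum>\<pi> | \<pi> permutes C. - ?f \<pi>)"
  proof (rule sum.cong[OF refl])
    fix \<pi> assume "\<pi> \<in> {\<pi>. \<pi> permutes C}"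
    then have "permutation \<pi>" using \<open>finite C\<close> by (auto simp: permutation_permutes)
    moreover have "permutation t" using t \<open>finite C\<close> by (auto simp: permutation_permutes)
    moreover have "sign t = -1" unfolding t_def by (simp add: sign_swap_id pq(3))
    moreover have "perm_tensor n (\<sigma> \<circ> (\<pi> \<circ> t)) i i' = perm_tensor n (\<sigma> \<circ> \<pi>) i i'"
      using perm_tensor_comp[OF tn, of "\<sigma> \<circ> \<pi>" i i'] it tt by (simp add: comp_assoc)
    ultimately show "?f (\<pi> \<circ> t) = - ?f \<pi>"
      by (simp add: sign_compose)
  qed
  finally show ?thesis by (simp add: sum_negf)
qed

text \<open>Straightening: a decreasing subsequence of length \<open>N + 1\<close> lets the antisymmetrizer on its
  positions rewrite \<open>\<sigma>\<close> in terms of permutations that are smaller in the lexicographic order, since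
  the decreasing arrangement is the lexicographically largest one.\<close>

lemma perm_tensor_in_span:
  assumes "\<rho> permutes {1..n}"
  shows "\<exists>c. \<forall>(i :: nat \<Rightarrow> 'N::finite) i'.
    perm_tensor n \<rho> i i' = (\<Sum>\<sigma>\<in>perms_no_decreasing CARD('N) n. c \<sigma> * perm_tensor n \<sigma> i i')"
proof -
  let ?P = "{\<rho>. \<rho> permutes {1..n}}"
  let ?S = "perms_no_decreasing CARD('N) n"
  let ?r = "{(\<rho>, \<sigma>). \<rho> \<in> ?P \<and> \<sigma> \<in> ?P \<and> lex_less \<rho> \<sigma>}"
  have "wf ?r" by (rule wf_lex_less_on(1)) (simp add: finite_permutations)
  then show ?thesis using assms
  proof (induction \<rho> rule: wf_induct_rule)
    case (less \<rho>)
    show ?case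
    proof (cases "\<rho> \<in> ?S")
      case True
      show ?thesis
      proof (intro exI[of _ "\<lambda>\<sigma>. of_bool (\<sigma> = \<rho>)"] allI)
        fix i i' :: "nat \<Rightarrow> 'N"
        have "(\<Sum>\<sigma>\<in>?S. of_bool (\<sigma> = \<rho>) * perm_tensor n \<sigma> i i')
            = (\<Sum>\<sigma>\<in>?S. if \<sigma> = \<rho> then perm_tensor n \<sigma> i i' else 0)"
          by (intro sum.cong) auto
        then show "perm_tensor n \<rho> i i' = (\<Sum>\<sigma>\<in>?S. of_bool (\<sigma> = \<rho>) * perm_tensor n \<sigma> i i')"
          using True by (simp add: finite_perms_no_decreasing)
      qed
    next
      case False
      then obtain C where C: "C \<subseteq> {1..n}" "card C = CARD('N) + 1"
        "\<forall>a\<in>C. \<forall>b\<in>C. a < b \<longrightarrow> \<rho> b < \<rho> a"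
        using less.prems unfolding perms_no_decreasing_iff by blast
      let ?Q = "{\<pi>. \<pi> permutes C} - {id}"
      have finC: "finite C" using C(1) finite_subset by blast
      have per: "\<rho> \<circ> \<pi> permutes {1..n}" if "\<pi> \<in> ?Q" for \<pi>
        using that less.prems permutes_subset[OF _ C(1)] by (auto intro: permutes_compose)
      \<comment> \<open>At the least moved point \<open>k\<close> both \<open>k < \<pi> k\<close>
        lie in \<open>C\<close>, where \<open>\<rho>\<close> decreases, so
        \<open>\<rho> (\<pi> k) < \<rho> k\<close>; before \<open>k\<close> nothing changes.\<close>
      have lexl: "lex_less (\<rho> \<circ> \<pi>) \<rho>" if "\<pi> \<in> ?Q" for \<pi>
      proof -
        from that have \<pi>: "\<pi> permutes C" "\<pi> \<noteq> id" by auto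
        obtain k where k: "k < \<pi> k" "\<And>l. l < k \<Longrightarrow> \<pi> l = l"
          using inj_first_moved[OF permutes_inj[OF \<pi>(1)] \<pi>(2)] by blast
        have "k \<in> C" using k(1) \<pi>(1) by (metis less_irrefl permutes_not_in)
        then have "\<pi> k \<in> C" using \<pi>(1) by (simp add: permutes_in_image)
        with C(3) k \<open>k \<in> C\<close> show ?thesis
          unfolding lex_less_def by (intro exI[of _ k]) auto
      qed
      \<comment> \<open>The coefficients must be uniform in the tuples, so they are chosen for each
        \<open>\<pi>\<close> before \<open>i\<close> and \<open>i'\<close> are fixed.\<close>
      have "\<forall>\<pi>\<in>?Q. \<exists>c. \<forall>(i :: nat \<Rightarrow> 'N) i'.
          perm_tensor n (\<rho> \<circ> \<pi>) i i' = (\<Sum>\<sigma>\<in>?S. c \<sigma> * perm_tensor n \<sigma> i i')"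
        using less.IH less.prems per lexl by blast
      from bchoice[OF this] obtain c where c: "\<And>\<pi> (i :: nat \<Rightarrow> 'N) i'. \<pi> \<in> ?Q \<Longrightarrow>
          perm_tensor n (\<rho> \<circ> \<pi>) i i' = (\<Sum>\<sigma>\<in>?S. c \<pi> \<sigma> * perm_tensor n \<sigma> i i')"
        by blast
      show ?thesis
      proof (intro exI[of _ "\<lambda>\<sigma>. - (\<Sum>\<pi>\<in>?Q. of_int (sign \<pi>) * c \<pi> \<sigma>)"] allI)
        fix i i' :: "nat \<Rightarrow> 'N"
        let ?f = "\<lambda>\<pi>. of_int (sign \<pi>) * perm_tensor n (\<rho> \<circ> \<pi>) i i'"
        have "(\<Sum>\<pi> | \<pi> permutes C. ?f \<pi>) = 0"
          by (rule antisymmetrizer_zero[OF C(1,2) less.prems])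
        moreover have "(\<Sum>\<pi> | \<pi> permutes C. ?f \<pi>) = ?f id + (\<Sum>\<pi>\<in>?Q. ?f \<pi>)"
          by (rule sum.remove) (auto simp: finite_permutations finC permutes_id)
        ultimately have "perm_tensor n \<rho> i i' = - (\<Sum>\<pi>\<in>?Q. ?f \<pi>)"
          by (simp add: sign_id add_eq_0_iff2)
        also have "(\<Sum>\<pi>\<in>?Q. ?f \<pi>)
            = (\<Sum>\<pi>\<in>?Q. of_int (sign \<pi>) * (\<Sum>\<sigma>\<in>?S. c \<pi> \<sigma> * perm_tensor n \<sigma> i i'))"
          by (intro sum.cong refl) (simp only: c)
        also have "\<dots> = (\<Sum>\<sigma>\<in>?S. (\<Sum>\<pi>\<in>?Q. of_int (sign \<pi>) * c \<pi> \<sigma>) * perm_tensor n \<sigma> i i')"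
          unfolding sum_distrib_left sum_distrib_right
          by (subst sum.swap) (simp add: mult_ac)
        finally show "perm_tensor n \<rho> i i' =
            (\<Sum>\<sigma>\<in>?S. - (\<Sum>\<pi>\<in>?Q. of_int (sign \<pi>) * c \<pi> \<sigma>) * perm_tensor n \<sigma> i i')"
          by (simp add: sum_negf)
      qed
    qed
  qed
qed

text \<open>Colour \<open>{1..n}\<close> with \<open>N\<close> colours so that \<open>\<sigma>\<close> increases on every colour class. Among the
  permutations with the same image of each class, \<open>\<sigma>\<close> is then lexicographically smallest.\<close>

lemma perm_tensor_separating_tuples:
  assumes "\<sigma> \<in> perms_no_decreasing CARD('N::finite) n"
  obtains i i' :: "nat \<Rightarrow> 'N::finite" where "i \<in> tuples n" and "i' \<in> tuples n"
    and "perm_tensor n \<sigma> i i' = 1"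
    and "\<And>\<tau>. \<tau> permutes {1..n} \<Longrightarrow> \<tau> \<noteq> \<sigma> \<Longrightarrow> perm_tensor n \<tau> i i' \<noteq> 0 \<Longrightarrow> lex_less \<sigma> \<tau>"
proof -
  note per = perms_no_decreasing_permutes[OF assms]
  obtain c :: "nat \<Rightarrow> nat" where c: "c ` {1..n} \<subseteq> {1..CARD('N)}"
    and incr: "\<And>k l. k \<in> {1..n} \<Longrightarrow> l \<in> {1..n} \<Longrightarrow> k < l \<Longrightarrow> c k = c l \<Longrightarrow> \<sigma> k < \<sigma> l"
    using perms_no_decreasing_colouring[OF assms] by blast
  obtain h :: "nat \<Rightarrow> 'N" where h: "bij_betw h {1..CARD('N)} UNIV"
    using ex_bij_betw_nat_finite_1[OF finite_class.finite_UNIV] by blast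
  define i where "i = (\<lambda>k. if k \<in> {1..n} then h (c k) else undefined)"
  \<comment> \<open>This makes \<open>i = i' \<circ> \<sigma>\<close>, hence the value 1 at
    \<open>\<sigma>\<close>.\<close>
  define i' where "i' = i \<circ> inv \<sigma>"
  have i: "i \<in> tuples n" by (auto simp: i_def)
  have i': "i' \<in> tuples n" unfolding i'_def by (rule tuples_comp[OF i permutes_inv[OF per]])
  have same: "c k = c l" if "k \<in> {1..n}" "l \<in> {1..n}" "i k = i l" for k l
  proof (rule inj_onD[OF bij_betw_imp_inj_on[OF h]])
    show "h (c k) = h (c l)" using that by (simp only: i_def if_True)
  qed (use c that in blast)+
  have one: "perm_tensor n \<sigma> i i' = 1"
    unfolding perm_tensor_def i'_def using permutes_inverses[OF per] by simp
  have "lex_less \<sigma> \<tau>" if \<tau>: "\<tau> permutes {1..n}" "\<tau> \<noteq> \<sigma>" "perm_tensor n \<tau> i i' \<noteq> 0" for \<tau>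
  proof -
    \<comment> \<open>A nonzero value at \<open>\<tau>\<close> says that \<open>\<pi>\<close>
      preserves colours. At its least moved point, \<open>k < \<pi> k\<close> have the same colour,
      so \<open>\<sigma> k < \<sigma> (\<pi> k) = \<tau> k\<close>.\<close>
    define \<pi> where "\<pi> = inv \<sigma> \<circ> \<tau>"
    have \<pi>: "\<pi> permutes {1..n}"
      unfolding \<pi>_def using \<tau>(1) permutes_inv[OF per] by (rule permutes_compose)
    have \<tau>_eq: "\<tau> k = \<sigma> (\<pi> k)" for k
      unfolding \<pi>_def using permutes_inverses[OF per] by simp
    then have "\<pi> \<noteq> id" using \<tau>(2) by auto
    then obtain k where k: "k < \<pi> k" "\<And>l. l < k \<Longrightarrow> \<pi> l = l"
      using inj_first_moved[OF permutes_inj[OF \<pi>]] by blast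
    have kn: "k \<in> {1..n}" using k(1) \<pi> by (metis less_irrefl permutes_not_in)
    then have \<pi>n: "\<pi> k \<in> {1..n}" using permutes_in_image[OF \<pi>] by simp
    have "i k = i (\<pi> k)"
      using \<tau>(3) kn unfolding perm_tensor_def i'_def \<pi>_def by auto
    then have "\<sigma> k < \<tau> k"
      using incr[OF kn \<pi>n k(1)] same[OF kn \<pi>n] \<tau>_eq by simp
    then show ?thesis
      unfolding lex_less_def using \<tau>_eq k(2) by (intro exI[of _ k]) auto
  qed
  with i i' one show thesis by (rule that)
qed

text \<open>Evaluation at the separating tuples of \<open>\<sigma>\<close> isolates
  \<open>x \<sigma>\<close>: any other \<open>\<tau>\<close> with a nonzero value is
  lexicographically larger, and there \<open>x \<tau> = 0\<close> by induction. The induction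
  therefore starts at the largest permutations.\<close>

lemma perm_tensors_independent:
  assumes "\<And>i i' :: nat \<Rightarrow> 'N::finite. i \<in> tuples n \<Longrightarrow> i' \<in> tuples n \<Longrightarrow>
      (\<Sum>\<tau>\<in>perms_no_decreasing CARD('N) n. x \<tau> * perm_tensor n \<tau> i i') = 0"
    and "\<sigma> \<in> perms_no_decreasing CARD('N::finite) n"
  shows "x \<sigma> = 0"
proof -
  let ?S = "perms_no_decreasing CARD('N) n"
  have "wf {(\<sigma>, \<rho>). \<rho> \<in> ?S \<and> \<sigma> \<in> ?S \<and> lex_less \<rho> \<sigma>}"
    by (rule wf_lex_less_on(2)[OF finite_perms_no_decreasing])
  then show ?thesis using assms(2)
  proof (induction \<sigma> rule: wf_induct_rule)
    case (less \<sigma>)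
    obtain i i' :: "nat \<Rightarrow> 'N" where i: "i \<in> tuples n" "i' \<in> tuples n"
      and one: "perm_tensor n \<sigma> i i' = 1"
      and lexl: "\<And>\<tau>. \<tau> permutes {1..n} \<Longrightarrow> \<tau> \<noteq> \<sigma> \<Longrightarrow> perm_tensor n \<tau> i i' \<noteq> 0 \<Longrightarrow> lex_less \<sigma> \<tau>"
      using perm_tensor_separating_tuples[OF less.prems] by blast
    have "x \<tau> * perm_tensor n \<tau> i i' = 0" if "\<tau> \<in> ?S - {\<sigma>}" for \<tau>
      using that less.IH[of \<tau>] lexl[of \<tau>] less.prems perms_no_decreasing_permutes by auto
    then have "(\<Sum>\<tau>\<in>?S - {\<sigma>}. x \<tau> * perm_tensor n \<tau> i i') = 0"
      by (rule sum.neutral[OF ballI])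
    then have "(\<Sum>\<tau>\<in>?S. x \<tau> * perm_tensor n \<tau> i i') = x \<sigma> * perm_tensor n \<sigma> i i'"
      by (subst sum.remove[OF finite_perms_no_decreasing less.prems]) simp
    with assms(1)[OF i] one show ?case by simp
  qed
qed

section \<open>The Gram matrix\<close>

text \<open>A fixed tuple is constant on each cycle and otherwise free. \<open>?F\<close> spreads a
  choice of one value per orbit over \<open>{1..n}\<close>; \<open>?G\<close> reads it off at an
  arbitrary representative of the orbit.\<close>

lemma card_tuples_fixed_by:
  assumes "\<rho> permutes {1..n}"
  shows "card {i \<in> tuples n. i \<circ> \<rho> = (i :: nat \<Rightarrow> 'N::finite)} = CARD('N) ^ num_cycles n \<rho>"
proof -
  let ?O = "orbit \<rho> ` {1..n}"
  let ?I = "{i \<in> tuples n. i \<circ> \<rho> = (i :: nat \<Rightarrow> 'N)}"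
  let ?F = "\<lambda>g :: nat set \<Rightarrow> 'N. \<lambda>k\<in>{1..n}. g (orbit \<rho> k)"
  let ?G = "\<lambda>i :: nat \<Rightarrow> 'N. \<lambda>p\<in>?O. i (SOME x. x \<in> p)"
  have per: "permutation \<rho>" using assms by (auto simp: permutation_permutes)
  have const: "i x = i k" if "i \<circ> \<rho> = i" "x \<in> orbit \<rho> k" for i :: "nat \<Rightarrow> 'N" and x k
    using that(2) by induction (use that(1) in \<open>auto simp: fun_eq_iff\<close>)
  have some: "(SOME x. x \<in> orbit \<rho> k) \<in> orbit \<rho> k" for k
    using permutation_self_in_orbit[OF per] by (rule someI)
  have some_orbit: "orbit \<rho> (SOME x. x \<in> orbit \<rho> k) = orbit \<rho> k" for k
    by (rule orbit_cyclic_eq3[OF cyclic_on_orbit'[OF per] some])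
  have some_in: "(SOME x. x \<in> orbit \<rho> k) \<in> {1..n}" if "k \<in> {1..n}" for k
    using some permutes_orbit_subset[OF assms that] by blast
  have "bij_betw ?F (?O \<rightarrow>\<^sub>E UNIV) ?I"
  proof (rule bij_betw_byWitness[where f' = ?G])
    show "\<forall>g\<in>?O \<rightarrow>\<^sub>E UNIV. ?G (?F g) = g"
    proof
      fix g :: "nat set \<Rightarrow> 'N" assume g: "g \<in> ?O \<rightarrow>\<^sub>E UNIV"
      show "?G (?F g) = g"
      proof
        fix p
        show "?G (?F g) p = g p"
        proof (cases "p \<in> ?O")
          case True
          then obtain k where k: "k \<in> {1..n}" "p = orbit \<rho> k" by blast
          then show ?thesis using True some_in[OF k(1)] some_orbit[of k] by simp
        next
          case False
          then show ?thesis using g by (auto simp: PiE_def extensional_def)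
        qed
      qed
    qed
    show "\<forall>i\<in>?I. ?F (?G i) = i"
    proof
      fix i assume i: "i \<in> ?I"
      show "?F (?G i) = i"
      proof
        fix k
        show "?F (?G i) k = i k"
        proof (cases "k \<in> {1..n}")
          case True
          then show ?thesis using const[of i, OF _ some] i by simp
        next
          case False
          then show ?thesis using i by (auto simp: PiE_def extensional_def)
        qed
      qed
    qed
    show "?F ` (?O \<rightarrow>\<^sub>E UNIV) \<subseteq> ?I"
    proof (rule image_subsetI)
      fix g :: "nat set \<Rightarrow> 'N"
      have "?F g \<circ> \<rho> = ?F g"
        using permutes_in_image[OF assms] permutation_orbit_step[OF per]
        by (auto simp: fun_eq_iff restrict_def)
      then show "?F g \<in> ?I" by simp
    qed
    show "?G ` ?I \<subseteq> ?O \<rightarrow>\<^sub>E UNIV" by auto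
  qed
  then have "card ?I = card (?O \<rightarrow>\<^sub>E (UNIV :: 'N set))"
    by (simp add: bij_betw_same_card)
  then show ?thesis by (simp add: card_PiE num_cycles_def)
qed

lemma sum_perm_tensor_left:
  fixes f :: "(nat \<Rightarrow> 'N::finite) \<Rightarrow> complex"
  assumes "\<sigma> permutes {1..n}" and "i' \<in> tuples n"
  shows "(\<Sum>i\<in>tuples n. perm_tensor n \<sigma> i i' * f i) = f (i' \<circ> \<sigma>)"
proof -
  have "(\<Sum>i\<in>tuples n. perm_tensor n \<sigma> i i' * f i)
      = (\<Sum>i\<in>tuples n. if i = i' \<circ> \<sigma> then f i else 0)"
    by (intro sum.cong refl) (simp only: perm_tensor_on_tuples assms of_bool_def, simp)
  also have "\<dots> = f (i' \<circ> \<sigma>)"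
    using tuples_comp[OF assms(2,1)] finite_tuples[where 'a='N] by (simp del: PiE_iff)
  finally show ?thesis .
qed

text \<open>Summing over \<open>i\<close> forces \<open>i = i' \<circ> \<sigma>\<close>, and what
  remains counts the \<open>i'\<close> with \<open>i' \<circ> \<sigma> = i' \<circ> \<tau>\<close>,
  which are the tuples fixed by \<open>\<sigma> \<circ> inv \<tau>\<close>. All entries are 0 or 1,
  so this pairing is the Hermitian inner product.\<close>

lemma perm_tensor_gram:
  assumes "\<sigma> permutes {1..n}" and "\<tau> permutes {1..n}"
  shows "(\<Sum>i\<in>tuples n. \<Sum>i'\<in>tuples n.
      perm_tensor n \<sigma> i i' * perm_tensor n \<tau> i (i' :: nat \<Rightarrow> 'N::finite)) =
      gram_matrix CARD('N) n \<sigma> \<tau>"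
proof -
  let ?\<rho> = "\<sigma> \<circ> inv \<tau>"
  have \<rho>: "?\<rho> permutes {1..n}"
    by (rule permutes_compose[OF permutes_inv[OF assms(2)] assms(1)])
  have "(\<Sum>i\<in>tuples n. \<Sum>i'\<in>tuples n.
      perm_tensor n \<sigma> i i' * perm_tensor n \<tau> i (i' :: nat \<Rightarrow> 'N))
      = (\<Sum>i'\<in>tuples n. \<Sum>i\<in>tuples n. perm_tensor n \<sigma> i i' * perm_tensor n \<tau> i (i' :: nat \<Rightarrow> 'N))"
    by (rule sum.swap)
  also have "\<dots> = (\<Sum>i'\<in>tuples n. perm_tensor n \<tau> (i' \<circ> \<sigma>) (i' :: nat \<Rightarrow> 'N))"
    by (intro sum.cong refl sum_perm_tensor_left assms)
  also have "\<dots> = (\<Sum>i'\<in>tuples n. of_bool (i' \<circ> ?\<rho> = (i' :: nat \<Rightarrow> 'N)))"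
  proof (intro sum.cong refl)
    fix i' :: "nat \<Rightarrow> 'N" assume i': "i' \<in> tuples n"
    have "i' \<circ> \<sigma> = i' \<circ> \<tau> \<longleftrightarrow> i' \<circ> ?\<rho> = i'"
    proof
      assume "i' \<circ> \<sigma> = i' \<circ> \<tau>"
      then have "i' \<circ> ?\<rho> = i' \<circ> \<tau> \<circ> inv \<tau>" by (simp add: o_assoc)
      then show "i' \<circ> ?\<rho> = i'" using permutes_inv_o[OF assms(2)] by (simp add: comp_assoc)
    next
      assume "i' \<circ> ?\<rho> = i'"
      then have "i' \<circ> \<tau> = i' \<circ> (\<sigma> \<circ> (inv \<tau> \<circ> \<tau>))" by (simp add: o_assoc)
      then show "i' \<circ> \<sigma> = i' \<circ> \<tau>" using permutes_inv_o[OF assms(2)] by simp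
    qed
    then show "perm_tensor n \<tau> (i' \<circ> \<sigma>) i' = of_bool (i' \<circ> ?\<rho> = i')"
      by (simp add: perm_tensor_on_tuples[OF tuples_comp[OF i' assms(1)] i' assms(2)] del: PiE_iff)
  qed
  also have "\<dots> = of_nat (card {i' \<in> tuples n. i' \<circ> ?\<rho> = (i' :: nat \<Rightarrow> 'N)})"
    using finite_tuples[where 'a='N, of n] by (simp only: sum_of_bool_eq Int_def mem_Collect_eq)
  finally show ?thesis
    unfolding card_tuples_fixed_by[OF \<rho>] gram_matrix_def by simp
qed

section \<open>Linear algebra over finite index sets\<close>

text \<open>Gaussian elimination, by induction on the equations: a pivot \<open>p\<close> in
  equation \<open>t\<close> costs one equation and one unknown; without a pivot, equation
  \<open>t\<close> holds trivially.\<close>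

lemma underdetermined_nontrivial_kernel:
  fixes A :: "'b \<Rightarrow> 'a \<Rightarrow> complex"
  assumes "finite T" and "finite S" and "card T < card S"
  shows "\<exists>x. (\<exists>s\<in>S. x s \<noteq> 0) \<and> (\<forall>t\<in>T. (\<Sum>s\<in>S. A t s * x s) = 0)"
  using assms
proof (induction T arbitrary: S A)
  case empty
  then have "S \<noteq> {}" by auto
  then show ?case by (intro exI[of _ "\<lambda>_. 1"]) auto
next
  case (insert t T)
  show ?case
  proof (cases "\<exists>p\<in>S. A t p \<noteq> 0")
    case False
    obtain x where "\<exists>s\<in>S. x s \<noteq> 0" "\<forall>t\<in>T. (\<Sum>s\<in>S. A t s * x s) = 0"
      using insert.IH[of S A] insert.hyps insert.prems by auto
    then show ?thesis using False by (intro exI[of _ x]) auto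
  next
    case True
    then obtain p where p: "p \<in> S" "A t p \<noteq> 0" by blast
    \<comment> \<open>Subtracting a multiple of row \<open>t\<close> clears column \<open>p\<close>
      in the other rows.\<close>
    define A' where "A' = (\<lambda>t' s. A t' s - A t' p * A t s / A t p)"
    have "card T < card (S - {p})"
      using insert.hyps insert.prems p(1) by simp
    then obtain x where x: "\<exists>s\<in>S - {p}. x s \<noteq> 0"
      "\<forall>t'\<in>T. (\<Sum>s\<in>S - {p}. A' t' s * x s) = 0"
      using insert.IH[of "S - {p}" A'] insert.prems by auto
    \<comment> \<open>Equation \<open>t\<close> solved for the pivot unknown.\<close>
    define q where "q = - (\<Sum>s\<in>S - {p}. A t s * x s) / A t p"
    define y where "y = x(p := q)"
    have sum_y: "(\<Sum>s\<in>S. A t' s * y s) = A t' p * q + (\<Sum>s\<in>S - {p}. A t' s * x s)" for t'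
    proof -
      have "(\<Sum>s\<in>S. A t' s * y s) = A t' p * y p + (\<Sum>s\<in>S - {p}. A t' s * y s)"
        by (rule sum.remove[OF insert.prems(1) p(1)])
      also have "(\<Sum>s\<in>S - {p}. A t' s * y s) = (\<Sum>s\<in>S - {p}. A t' s * x s)"
        by (intro sum.cong) (auto simp: y_def)
      finally show ?thesis by (simp add: y_def)
    qed
    have "(\<Sum>s\<in>S. A t' s * y s) = 0" if "t' \<in> T" for t'
    proof -
      have "0 = (\<Sum>s\<in>S - {p}. A' t' s * x s)" using x(2) that by simp
      also have "\<dots> = (\<Sum>s\<in>S - {p}. A t' s * x s) - A t' p / A t p * (\<Sum>s\<in>S - {p}. A t s * x s)"
        unfolding A'_def by (simp add: sum_subtractf sum_distrib_left algebra_simps)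
      finally show ?thesis unfolding sum_y q_def by simp
    qed
    moreover have "(\<Sum>s\<in>S. A t s * y s) = 0"
      unfolding sum_y q_def using p(2) by simp
    moreover have "\<exists>s\<in>S. y s \<noteq> 0"
      using x(1) by (auto simp: y_def)
    ultimately show ?thesis by (intro exI[of _ y]) auto
  qed
qed

text \<open>Each column of a right inverse B comes from an underdetermined system. That B is also a
  left inverse follows since A (B A - 1) = 0 and A has trivial kernel.\<close>

lemma invertible_on_if_trivial_kernel:
  fixes A :: "'a \<Rightarrow> 'a \<Rightarrow> complex"
  assumes "finite S"
    and ker: "\<And>x. (\<And>s. s \<in> S \<Longrightarrow> (\<Sum>t\<in>S. A s t * x t) = 0) \<Longrightarrow> (\<And>t. t \<in> S \<Longrightarrow> x t = 0)"
  shows "invertible_on S A"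
proof -
  have "\<exists>b. \<forall>s\<in>S. (\<Sum>t\<in>S. A s t * b t) = of_bool (s = u)" if "u \<in> S" for u
  proof -
    \<comment> \<open>The extra column \<open>None\<close> is the unit vector at \<open>u\<close>. A
      nontrivial solution has a nonzero \<open>None\<close> entry because \<open>A\<close> has
      trivial kernel, and dividing by the negative of that entry yields column \<open>u\<close> of
      the inverse.\<close>
    define A' where "A' = (\<lambda>s o'. case o' of None \<Rightarrow> of_bool (s = u) | Some t \<Rightarrow> A s t)"
    let ?S' = "insert None (Some ` S)"
    have "card S < card ?S'"
      using assms(1) by (simp add: card_image)
    then obtain x where x: "\<exists>t\<in>?S'. x t \<noteq> 0" "\<forall>s\<in>S. (\<Sum>t\<in>?S'. A' s t * x t) = 0"
      using underdetermined_nontrivial_kernel[of S ?S' A'] assms(1) by auto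
    have eq: "of_bool (s = u) * x None + (\<Sum>t\<in>S. A s t * x (Some t)) = 0" if "s \<in> S" for s
      using x(2) that assms(1) by (simp add: sum.reindex A'_def)
    have "x None \<noteq> 0"
    proof
      assume "x None = 0"
      then have "x (Some t) = 0" if "t \<in> S" for t
        using ker[of "\<lambda>t. x (Some t)"] eq that by simp
      with x(1) \<open>x None = 0\<close> show False by auto
    qed
    have "(\<Sum>t\<in>S. A s t * (- x (Some t) / x None)) = of_bool (s = u)" if "s \<in> S" for s
    proof -
      have "(\<Sum>t\<in>S. A s t * (- x (Some t) / x None)) = - (\<Sum>t\<in>S. A s t * x (Some t)) / x None"
        by (simp add: sum_divide_distrib sum_negf)
      also have "\<dots> = of_bool (s = u)"
        using eq[OF that] \<open>x None \<noteq> 0\<close> by (simp add: field_simps add_eq_0_iff)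
      finally show ?thesis .
    qed
    then show ?thesis by (intro exI ballI)
  qed
  then have "\<forall>u\<in>S. \<exists>b. \<forall>s\<in>S. (\<Sum>t\<in>S. A s t * b t) = of_bool (s = u)" by blast
  from bchoice[OF this] obtain b where
    b: "\<And>u s. u \<in> S \<Longrightarrow> s \<in> S \<Longrightarrow> (\<Sum>t\<in>S. A s t * b u t) = of_bool (s = u)" by blast
  \<comment> \<open>\<open>ker\<close> is applied to column \<open>y\<close> of B A - 1.\<close>
  have "(\<Sum>z\<in>S. b z x * A z y) - of_bool (x = y) = 0" if "x \<in> S" "y \<in> S" for x y
  proof (rule ker[of "\<lambda>x. (\<Sum>z\<in>S. b z x * A z y) - of_bool (x = y)"])
    fix s assume s: "s \<in> S"
    have "(\<Sum>t\<in>S. A s t * (\<Sum>z\<in>S. b z t * A z y)) = (\<Sum>z\<in>S. (\<Sum>t\<in>S. A s t * b z t) * A z y)"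
      unfolding sum_distrib_left sum_distrib_right by (subst sum.swap) (simp add: mult_ac)
    also have "\<dots> = (\<Sum>z\<in>S. of_bool (s = z) * A z y)"
      by (intro sum.cong refl) (simp add: b s)
    also have "\<dots> = (\<Sum>z\<in>S. if s = z then A z y else 0)"
      by (intro sum.cong) auto
    also have "\<dots> = A s y" using s assms(1) by simp
    also have "\<dots> = (\<Sum>t\<in>S. if t = y then A s t else 0)"
      using that(2) assms(1) by simp
    also have "\<dots> = (\<Sum>t\<in>S. A s t * of_bool (t = y))"
      by (intro sum.cong) auto
    finally show "(\<Sum>t\<in>S. A s t * ((\<Sum>z\<in>S. b z t * A z y) - of_bool (t = y))) = 0"
      by (simp add: right_diff_distrib sum_subtractf)
  qed (use that in auto)
  with b have "is_inverse_on S A (\<lambda>t u. b u t)"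
    unfolding is_inverse_on_def by simp
  then show ?thesis unfolding invertible_on_def by blast
qed

lemma is_inverse_on_inverse_on: "invertible_on S A \<Longrightarrow> is_inverse_on S A (inverse_on S A)"
  unfolding invertible_on_def inverse_on_def by (rule someI_ex[of "is_inverse_on S A"])

text \<open>A kernel vector \<open>x\<close> gives a combination \<open>y\<close> of the tensors
  that is orthogonal to each of them, hence to itself. So \<open>y\<close> vanishes, and
  independence gives \<open>x = 0\<close>.\<close>

lemma gram_matrix_invertible:
  "invertible_on (perms_no_decreasing CARD('N::finite) n) (gram_matrix CARD('N) n)"
proof (rule invertible_on_if_trivial_kernel[OF finite_perms_no_decreasing])
  let ?S = "perms_no_decreasing CARD('N) n"
  let ?v = "\<lambda>\<sigma> (i, i'). perm_tensor n \<sigma> i (i' :: nat \<Rightarrow> 'N)"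
  let ?X = "tuples n \<times> tuples n :: ((nat \<Rightarrow> 'N) \<times> (nat \<Rightarrow> 'N)) set"
  fix x \<tau>
  assume ker: "\<And>\<sigma>. \<sigma> \<in> ?S \<Longrightarrow> (\<Sum>\<tau>\<in>?S. gram_matrix CARD('N) n \<sigma> \<tau> * x \<tau>) = 0"
    and \<tau>: "\<tau> \<in> ?S"
  define y where "y = (\<lambda>p. \<Sum>\<tau>\<in>?S. x \<tau> * ?v \<tau> p)"
  have gram: "(\<Sum>p\<in>?X. ?v \<sigma> p * ?v \<tau> p) = gram_matrix CARD('N) n \<sigma> \<tau>"
    if "\<sigma> \<in> ?S" "\<tau> \<in> ?S" for \<sigma> \<tau>
    using perm_tensor_gram[where 'N='N, OF that[THEN perms_no_decreasing_permutes]]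
    by (simp add: sum.cartesian_product case_prod_unfold)
  have orth: "(\<Sum>p\<in>?X. ?v \<sigma> p * y p) = 0" if "\<sigma> \<in> ?S" for \<sigma>
  proof -
    have "(\<Sum>p\<in>?X. ?v \<sigma> p * y p) = (\<Sum>\<tau>\<in>?S. (\<Sum>p\<in>?X. ?v \<sigma> p * ?v \<tau> p) * x \<tau>)"
      unfolding y_def sum_distrib_left sum_distrib_right by (subst sum.swap) (simp add: mult_ac)
    also have "\<dots> = (\<Sum>\<tau>\<in>?S. gram_matrix CARD('N) n \<sigma> \<tau> * x \<tau>)"
      by (intro sum.cong refl) (simp only: gram that)
    finally show ?thesis using ker[OF that] by simp
  qed
  have real_v: "cnj (?v \<sigma> p) = ?v \<sigma> p" for \<sigma> p
    by (auto simp: perm_tensor_def split: prod.split)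
  have "complex_of_real (\<Sum>p\<in>?X. (cmod (y p))\<^sup>2) = (\<Sum>p\<in>?X. cnj (y p) * y p)"
    by (simp only: of_real_sum complex_norm_square mult.commute)
  also have "\<dots> = (\<Sum>p\<in>?X. \<Sum>\<sigma>\<in>?S. cnj (x \<sigma>) * (?v \<sigma> p * y p))"
  proof (rule sum.cong[OF refl])
    fix p
    have "cnj (y p) = (\<Sum>\<sigma>\<in>?S. cnj (x \<sigma>) * ?v \<sigma> p)"
      unfolding y_def cnj_sum complex_cnj_mult real_v ..
    then show "cnj (y p) * y p = (\<Sum>\<sigma>\<in>?S. cnj (x \<sigma>) * (?v \<sigma> p * y p))"
      by (simp add: sum_distrib_left mult_ac)
  qed
  also have "\<dots> = (\<Sum>\<sigma>\<in>?S. cnj (x \<sigma>) * (\<Sum>p\<in>?X. ?v \<sigma> p * y p))"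
    unfolding sum_distrib_left by (rule sum.swap)
  also have "\<dots> = 0" by (intro sum.neutral ballI) (simp only: orth mult_zero_right)
  finally have "(\<Sum>p\<in>?X. (cmod (y p))\<^sup>2) = 0" by (simp only: of_real_eq_0_iff)
  moreover have "finite ?X" by (intro finite_cartesian_product finite_tuples)
  ultimately have "y p = 0" if "p \<in> ?X" for p
    using that sum_nonneg_eq_0_iff[of ?X "\<lambda>p. (cmod (y p))\<^sup>2"] by auto
  then have "(\<Sum>\<tau>\<in>?S. x \<tau> * perm_tensor n \<tau> i (i' :: nat \<Rightarrow> 'N)) = 0"
    if "i \<in> tuples n" "i' \<in> tuples n" for i i'
    using that unfolding y_def by fastforce
  then show "x \<tau> = 0" by (rule perm_tensors_independent[OF _ \<tau>])
qed

section \<open>Operators commuting with symmetric kernels\<close>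

definition kernel_comp ::
  "nat \<Rightarrow> ((nat \<Rightarrow> 'N::finite) \<Rightarrow> (nat \<Rightarrow> 'N) \<Rightarrow> complex) \<Rightarrow> ((nat \<Rightarrow> 'N) \<Rightarrow> (nat \<Rightarrow> 'N) \<Rightarrow> complex) \<Rightarrow>
    (nat \<Rightarrow> 'N) \<Rightarrow> (nat \<Rightarrow> 'N) \<Rightarrow> complex" where
  "kernel_comp n K L i j = (\<Sum>k\<in>tuples n. K i k * L k j)"

text \<open>Kernels are total functions, but only their entries at tuples describe the operator;
  hence the bounded quantifiers.\<close>

definition commutes_with ::
  "nat \<Rightarrow> ((nat \<Rightarrow> 'N::finite) \<Rightarrow> (nat \<Rightarrow> 'N) \<Rightarrow> complex) \<Rightarrow> ((nat \<Rightarrow> 'N) \<Rightarrow> (nat \<Rightarrow> 'N) \<Rightarrow> complex) \<Rightarrow>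
    bool" where
  "commutes_with n W K \<longleftrightarrow>
     (\<forall>i\<in>tuples n. \<forall>j\<in>tuples n. kernel_comp n W K i j = kernel_comp n K W i j)"

lemma kernel_comp_assoc:
  "kernel_comp n (kernel_comp n K L) M i j = kernel_comp n K (kernel_comp n L M) i j"
  unfolding kernel_comp_def sum_distrib_left sum_distrib_right
  by (subst sum.swap) (simp add: mult_ac)

lemma kernel_comp_cong:
  assumes "\<And>k. k \<in> tuples n \<Longrightarrow> K i k = K' i k" and "\<And>k. k \<in> tuples n \<Longrightarrow> L k j = L' k j"
  shows "kernel_comp n K L i j = kernel_comp n K' L' i j"
  unfolding kernel_comp_def by (intro sum.cong refl) (simp only: assms)

lemma commutes_with_cong:
  assumes "commutes_with n W K"
    and "\<And>i j. i \<in> tuples n \<Longrightarrow> j \<in> tuples n \<Longrightarrow> K i j = L i j"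
  shows "commutes_with n W L"
proof -
  have "kernel_comp n W L i j = kernel_comp n W K i j"
    "kernel_comp n L W i j = kernel_comp n K W i j"
    if "i \<in> tuples n" "j \<in> tuples n" for i j
    by (rule kernel_comp_cong; simp only: assms(2) that)+
  with assms(1) show ?thesis unfolding commutes_with_def by simp
qed

text \<open>Together with \<open>commutes_with_sum\<close> this makes the commutant of
  \<open>W\<close> an algebra, so it contains everything that derivations generate.\<close>

lemma commutes_with_comp:
  assumes "commutes_with n W K" and "commutes_with n W L"
  shows "commutes_with n W (kernel_comp n K L)"
  unfolding commutes_with_def
proof (intro ballI)
  fix i j :: "nat \<Rightarrow> 'a" assume ij: "i \<in> tuples n" "j \<in> tuples n"
  have "kernel_comp n W (kernel_comp n K L) i j = kernel_comp n (kernel_comp n W K) L i j"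
    by (simp only: kernel_comp_assoc)
  also have "\<dots> = kernel_comp n (kernel_comp n K W) L i j"
    using assms(1) ij by (intro kernel_comp_cong[where L = L and L' = L]) (simp_all only: commutes_with_def)
  also have "\<dots> = kernel_comp n K (kernel_comp n W L) i j"
    by (simp only: kernel_comp_assoc)
  also have "\<dots> = kernel_comp n K (kernel_comp n L W) i j"
    using assms(2) ij by (intro kernel_comp_cong[where K = K and K' = K]) (simp_all only: commutes_with_def)
  finally show "kernel_comp n W (kernel_comp n K L) i j = kernel_comp n (kernel_comp n K L) W i j"
    by (simp only: kernel_comp_assoc)
qed

lemma kernel_comp_sum:
  "kernel_comp n W (\<lambda>i j. \<Sum>x\<in>A. c x * K x i j) i j = (\<Sum>x\<in>A. c x * kernel_comp n W (K x) i j)"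
  "kernel_comp n (\<lambda>i j. \<Sum>x\<in>A. c x * K x i j) W i j = (\<Sum>x\<in>A. c x * kernel_comp n (K x) W i j)"
  unfolding kernel_comp_def sum_distrib_left sum_distrib_right
  by (subst sum.swap, simp add: mult_ac)+

lemma commutes_with_sum:
  assumes "\<And>x. x \<in> A \<Longrightarrow> commutes_with n W (K x)"
  shows "commutes_with n W (\<lambda>i j. \<Sum>x\<in>A. c x * K x i j)"
  using assms unfolding commutes_with_def kernel_comp_sum by (auto intro!: sum.cong)

section \<open>Tensor products of matrices, derivations and symmetrization\<close>

text \<open>The kernel of the tensor product of \<open>X 1\<close>, ..., \<open>X n\<close>. The
  factors may differ, since derivations alter a single slot.\<close>

definition tensor ::
  "nat \<Rightarrow> (nat \<Rightarrow> complex ^ 'N ^ 'N) \<Rightarrow> (nat \<Rightarrow> 'N) \<Rightarrow> (nat \<Rightarrow> 'N) \<Rightarrow> complex" where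
  "tensor n X i j = (\<Prod>k=1..n. X k $ i k $ j k)"

lemma tensor_cong:
  "(\<And>k. k \<in> {1..n} \<Longrightarrow> X k = Y k) \<Longrightarrow> tensor n X i j = tensor n Y i j"
  unfolding tensor_def by (intro prod.cong) auto

lemma kernel_comp_tensor:
  fixes X Y :: "nat \<Rightarrow> complex ^ 'N::finite ^ 'N"
  shows "kernel_comp n (tensor n X) (tensor n Y) i j = tensor n (\<lambda>k. X k ** Y k) i j"
proof -
  have "tensor n (\<lambda>k. X k ** Y k) i j = (\<Prod>k=1..n. \<Sum>a\<in>UNIV. X k $ i k $ a * Y k $ a $ j k)"
    by (simp add: tensor_def matrix_matrix_mult_def)
  also have "\<dots> = (\<Sum>g\<in>tuples n. \<Prod>k=1..n. X k $ i k $ g k * Y k $ g k $ j k)"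
    by (rule prod_sum_PiE) auto
  finally show ?thesis by (simp add: kernel_comp_def tensor_def prod.distrib)
qed

lemma tensor_mat_1:
  assumes "i \<in> tuples n" and "j \<in> tuples n"
  shows "tensor n (\<lambda>_. mat 1) i j = of_bool (i = (j :: nat \<Rightarrow> 'N::finite))"
proof -
  have "tensor n (\<lambda>_. mat 1) i j = of_bool (\<forall>k\<in>{1..n}. i k = j k)"
    unfolding tensor_def mat_def by (auto intro!: prod.neutral prod_zero)
  also have "(\<forall>k\<in>{1..n}. i k = j k) \<longleftrightarrow> i = j"
    using tuples_eqI[OF assms] by auto
  finally show ?thesis .
qed

text \<open>The derivative of the \<open>n\<close>-th tensor power at the identity matrix in
  direction \<open>Y\<close>, that is, the Lie algebra action of \<open>Y\<close>.\<close>

definition tensor_deriv ::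
  "nat \<Rightarrow> complex ^ 'N ^ 'N \<Rightarrow> (nat \<Rightarrow> 'N) \<Rightarrow> (nat \<Rightarrow> 'N) \<Rightarrow> complex" where
  "tensor_deriv n Y i j = (\<Sum>q=1..n. tensor n ((\<lambda>_. mat 1)(q := Y)) i j)"

definition sym_tensor ::
  "nat \<Rightarrow> (nat \<Rightarrow> complex ^ 'N ^ 'N) \<Rightarrow> (nat \<Rightarrow> 'N) \<Rightarrow> (nat \<Rightarrow> 'N) \<Rightarrow> complex" where
  "sym_tensor n X i j = (\<Sum>\<pi> | \<pi> permutes {1..n}. tensor n (X \<circ> \<pi>) i j)"

text \<open>Isolating the factor with \<open>Y\<close> exhibits linearity in \<open>Y\<close> and
  matches the shape of the product rule.\<close>

lemma tensor_deriv_alt: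
  "tensor_deriv n Y i j =
     (\<Sum>q=1..n. Y $ i q $ j q * (\<Prod>k\<in>{1..n} - {q}. (mat 1 :: complex ^ 'N ^ 'N) $ i k $ j k))"
  unfolding tensor_deriv_def
proof (intro sum.cong refl)
  fix q assume "q \<in> {1..n}"
  then have "tensor n ((\<lambda>_. mat 1)(q := Y)) i j = Y $ i q $ j q *
      (\<Prod>k\<in>{1..n} - {q}. ((\<lambda>_. mat 1)(q := Y)) k $ i k $ j k)"
    unfolding tensor_def by (subst prod.remove[of _ q]) auto
  also have "(\<Prod>k\<in>{1..n} - {q}. ((\<lambda>_. mat 1)(q := Y)) k $ i k $ j k)
      = (\<Prod>k\<in>{1..n} - {q}. (mat 1 :: complex ^ 'N ^ 'N) $ i k $ j k)"
    by (intro prod.cong) auto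
  finally show "tensor n ((\<lambda>_. mat 1)(q := Y)) i j =
      Y $ i q $ j q * (\<Prod>k\<in>{1..n} - {q}. (mat 1 :: complex ^ 'N ^ 'N) $ i k $ j k)" .
qed

lemma sym_tensor_permute:
  assumes "\<pi> permutes {1..n}"
  shows "sym_tensor n (X \<circ> \<pi>) i j = sym_tensor n X i j"
  unfolding sym_tensor_def comp_assoc
  by (rule setum_permutations_compose_left[OF assms, symmetric])

text \<open>In the summand of \<open>\<pi>\<close>, a \<open>Y\<close> in slot \<open>q\<close>
  meets the factor \<open>X (\<pi> q)\<close>. Renaming \<open>l = \<pi> q\<close> moves the change
  into the family \<open>X\<close> before it is permuted, so the sum over \<open>\<pi>\<close> is
  again a symmetrization.\<close>

lemma kernel_comp_deriv_sym_tensor: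
  fixes X :: "nat \<Rightarrow> complex ^ 'N::finite ^ 'N"
  shows "kernel_comp n (tensor_deriv n Y) (sym_tensor n X) i j =
    (\<Sum>l=1..n. sym_tensor n (X(l := Y ** X l)) i j)"
proof -
  let ?P = "{\<pi>. \<pi> permutes {1..n}}"
  let ?Z = "\<lambda>q. (\<lambda>_. mat 1)(q := Y)"
  have "kernel_comp n (tensor_deriv n Y) (sym_tensor n X) i j =
      (\<Sum>\<pi>\<in>?P. \<Sum>q=1..n. kernel_comp n (tensor n (?Z q)) (tensor n (X \<circ> \<pi>)) i j)"
  proof -
    have "tensor_deriv n Y = (\<lambda>i j. \<Sum>q=1..n. tensor n (?Z q) i j)"
      by (intro ext) (simp add: tensor_deriv_def)
    moreover have "sym_tensor n X = (\<lambda>i j. \<Sum>\<pi>\<in>?P. tensor n (X \<circ> \<pi>) i j)"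
      by (intro ext) (simp add: sym_tensor_def)
    ultimately show ?thesis by (simp only: kernel_comp_sum[where c = "\<lambda>_. 1", unfolded mult_1])
  qed
  also have "\<dots> = (\<Sum>\<pi>\<in>?P. \<Sum>q=1..n. tensor n (X(\<pi> q := Y ** X (\<pi> q)) \<circ> \<pi>) i j)"
  proof (intro sum.cong refl)
    fix \<pi> q assume "\<pi> \<in> ?P"
    then have "inj \<pi>" using permutes_inj by auto
    then show "kernel_comp n (tensor n (?Z q)) (tensor n (X \<circ> \<pi>)) i j =
        tensor n (X(\<pi> q := Y ** X (\<pi> q)) \<circ> \<pi>) i j"
      unfolding kernel_comp_tensor by (intro tensor_cong) (auto dest: injD)
  qed
  also have "\<dots> = (\<Sum>\<pi>\<in>?P. \<Sum>l=1..n. tensor n (X(l := Y ** X l) \<circ> \<pi>) i j)"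
  proof (rule sum.cong[OF refl])
    fix \<pi> assume "\<pi> \<in> ?P"
    then have "bij_betw \<pi> {1..n} {1..n}" by (simp add: permutes_imp_bij)
    then show "(\<Sum>q=1..n. tensor n (X(\<pi> q := Y ** X (\<pi> q)) \<circ> \<pi>) i j) =
        (\<Sum>l=1..n. tensor n (X(l := Y ** X l) \<circ> \<pi>) i j)"
      by (rule sum.reindex_bij_betw)
  qed
  also have "\<dots> = (\<Sum>l=1..n. sym_tensor n (X(l := Y ** X l)) i j)"
    unfolding sym_tensor_def by (rule sum.swap)
  finally show ?thesis .
qed

text \<open>The number of slots of \<open>X\<close> that differ from the identity is increased one at a time: if \<open>X q\<close> is
  the identity and \<open>Y\<close> acts on \<open>sym_tensor n X\<close>, the summands where \<open>Y\<close> hits an identity slot all equal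
  \<open>sym_tensor n (X(q := Y))\<close>, and the other summands are covered by the induction hypothesis.\<close>

lemma commutes_with_sym_tensor:
  fixes W :: "(nat \<Rightarrow> 'N::finite) \<Rightarrow> (nat \<Rightarrow> 'N) \<Rightarrow> complex"
  assumes deriv: "\<And>Y. commutes_with n W (tensor_deriv n Y)"
  shows "commutes_with n W (sym_tensor n X)"
proof -
  have "commutes_with n W (sym_tensor n X)"
    if "finite A" "A \<subseteq> {1..n}" "\<And>l. l \<in> {1..n} - A \<Longrightarrow> X l = mat 1" for A X
    using that
  proof (induction A arbitrary: X)
    case empty
    \<comment> \<open>Every slot is the identity, so the symmetrized tensor is \<open>n!\<close>
      copies of the identity kernel.\<close>
    let ?id = "\<lambda>i j. \<Sum>\<pi> | \<pi> permutes {1..n}. 1 * tensor n (\<lambda>_. mat 1 :: complex ^ 'N ^ 'N) i j"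
    have "commutes_with n W (tensor n (\<lambda>_. mat 1))"
      unfolding commutes_with_def kernel_comp_def
    proof (intro ballI)
      fix i j :: "nat \<Rightarrow> 'N" assume ij: "i \<in> tuples n" "j \<in> tuples n"
      have "(\<Sum>k\<in>tuples n. W i k * tensor n (\<lambda>_. mat 1) k j) = (\<Sum>k\<in>tuples n. if k = j then W i k else 0)"
        by (intro sum.cong refl) (simp add: tensor_mat_1[OF _ ij(2)] del: PiE_iff)
      moreover have "(\<Sum>k\<in>tuples n. tensor n (\<lambda>_. mat 1) i k * W k j) = (\<Sum>k\<in>tuples n. if i = k then W k j else 0)"
        by (intro sum.cong refl) (simp add: tensor_mat_1[OF ij(1)] del: PiE_iff)
      ultimately show "(\<Sum>k\<in>tuples n. W i k * tensor n (\<lambda>_. mat 1) k j) =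
          (\<Sum>k\<in>tuples n. tensor n (\<lambda>_. mat 1) i k * W k j)"
        using ij finite_tuples[where 'a='N, of n] by (simp del: PiE_iff)
    qed
    then have "commutes_with n W ?id"
      by (intro commutes_with_sum)
    moreover have "?id = sym_tensor n X"
    proof (intro ext)
      fix i j
      have "X (\<pi> k) = mat 1" if "\<pi> permutes {1..n}" "k \<in> {1..n}" for \<pi> k
        using empty permutes_in_image[OF that(1)] that(2) by simp
      then show "?id i j = sym_tensor n X i j"
        unfolding sym_tensor_def mult_1 by (intro sum.cong refl tensor_cong) auto
    qed
    ultimately show ?case by simp
  next
    case (insert q A)
    \<comment> \<open>Slot \<open>q\<close> is emptied, so that acting with \<open>Y\<close> on the
      symmetrized \<open>X0\<close> can put the factor \<open>X q\<close> back.\<close>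
    define X0 where "X0 = X(q := mat 1)"
    define Y where "Y = X q"
    let ?Z = "\<lambda>l. sym_tensor n (X0(l := Y ** X0 l))"
    have sub: "A \<subseteq> {1..n}" "q \<in> {1..n}" using insert.prems(1) by auto
    have X0_1: "X0 l = mat 1" if "l \<in> {1..n} - A" for l
      using insert.prems(2)[of l] that by (auto simp: X0_def)
    have comm_A: "commutes_with n W (?Z l)" if "l \<in> A" for l
      using X0_1 that by (intro insert.IH[OF sub(1)]) auto
    have "commutes_with n W (sym_tensor n X0)"
      by (rule insert.IH[OF sub(1) X0_1])
    with deriv[of Y] have comm: "commutes_with n W (kernel_comp n (tensor_deriv n Y) (sym_tensor n X0))"
      by (rule commutes_with_comp)
    have Z_eq: "?Z l i j = sym_tensor n X i j" if l: "l \<in> {1..n} - A" for l i j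
    proof -
      \<comment> \<open>Slots \<open>q\<close> and \<open>l\<close> of \<open>X0\<close> both carry
        the identity, so putting \<open>Y\<close> into \<open>l\<close> gives \<open>X\<close> with
        these two slots exchanged.\<close>
      let ?t = "Transposition.transpose q l"
      have t: "?t permutes {1..n}" by (rule permutes_swap_id) (use l sub in auto)
      have "X0(l := Y ** X0 l) = X \<circ> ?t"
      proof
        fix k
        show "(X0(l := Y ** X0 l)) k = (X \<circ> ?t) k"
          using X0_1[OF l] insert.prems(2)[of l] l
          by (cases "k = l"; cases "k = q") (auto simp: X0_def Y_def Transposition.transpose_def)
      qed
      then show ?thesis using sym_tensor_permute[OF t] by simp
    qed
    define m where "m = complex_of_nat (card ({1..n} - A))"
    have "m \<noteq> 0"
      using sub(2) insert.hyps(2) unfolding m_def by (auto simp: card_eq_0_iff)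
    have split: "kernel_comp n (tensor_deriv n Y) (sym_tensor n X0) i j =
        (\<Sum>l\<in>A. ?Z l i j) + m * sym_tensor n X i j" for i j
    proof -
      have "kernel_comp n (tensor_deriv n Y) (sym_tensor n X0) i j = (\<Sum>l=1..n. ?Z l i j)"
        by (rule kernel_comp_deriv_sym_tensor)
      also have "\<dots> = (\<Sum>l\<in>{1..n} - A. ?Z l i j) + (\<Sum>l\<in>A. ?Z l i j)"
        by (rule sum.subset_diff[OF sub(1)]) simp
      also have "(\<Sum>l\<in>{1..n} - A. ?Z l i j) = (\<Sum>l\<in>{1..n} - A. sym_tensor n X i j)"
        by (intro sum.cong refl Z_eq)
      finally show ?thesis by (simp only: m_def sum_constant add.commute)
    qed
    \<comment> \<open>\<open>split\<close> is solved for the wanted kernel. Indexing the two known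
      kernels by \<open>bool\<close> gives the combination the form required by
      \<open>commutes_with_sum\<close>.\<close>
    let ?K = "\<lambda>b i j. if b then kernel_comp n (tensor_deriv n Y) (sym_tensor n X0) i j
        else \<Sum>l\<in>A. 1 * ?Z l i j"
    have "commutes_with n W (?K b)" for b
      using comm commutes_with_sum[of A n W ?Z "\<lambda>_. 1", OF comm_A] by (cases b) simp_all
    then have "commutes_with n W (\<lambda>i j. \<Sum>b\<in>UNIV. (if b then 1 / m else - 1 / m) * ?K b i j)"
      by (rule commutes_with_sum)
    then show ?case
      by (rule commutes_with_cong) (use \<open>m \<noteq> 0\<close> in \<open>simp add: UNIV_bool split field_simps\<close>)
  qed
  from this[of "{1..n}" X] show ?thesis by simp
qed

definition matrix_unit :: "'N \<Rightarrow> 'N \<Rightarrow> complex ^ 'N ^ 'N" where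
  "matrix_unit a b = (\<chi> x y. of_bool (x = a \<and> y = b))"

text \<open>\<open>K\<close> is expanded in products of matrix units. At \<open>(i, j)\<close> the
  summand of \<open>\<pi>\<close> survives only for \<open>a = i \<circ> inv \<pi>\<close> and
  \<open>b = j \<circ> inv \<pi>\<close>, where symmetry gives \<open>K a b = K i j\<close>; the
  \<open>n!\<close> equal terms cancel the factor \<open>fact n\<close>.\<close>

lemma symmetric_kernel_expansion:
  fixes K :: "(nat \<Rightarrow> 'N::finite) \<Rightarrow> (nat \<Rightarrow> 'N) \<Rightarrow> complex"
  assumes sym: "\<And>\<pi> i j. \<pi> permutes {1..n} \<Longrightarrow> i \<in> tuples n \<Longrightarrow> j \<in> tuples n \<Longrightarrow>
      K (i \<circ> \<pi>) (j \<circ> \<pi>) = K i j"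
    and "i \<in> tuples n" and "j \<in> tuples n"
  shows "(\<Sum>(a, b)\<in>tuples n \<times> tuples n.
      K a b / fact n * sym_tensor n (\<lambda>l. matrix_unit (a l) (b l)) i j) = K i j"
proof -
  let ?P = "{\<pi>. \<pi> permutes {1..n}}"
  have eq: "tensor n ((\<lambda>l. matrix_unit (a l) (b l)) \<circ> \<pi>) i j =
      of_bool (a = i \<circ> inv \<pi> \<and> b = j \<circ> inv \<pi>)"
    if "a \<in> tuples n" "b \<in> tuples n" "\<pi> \<in> ?P" for a b \<pi>
  proof -
    from that(3) have \<pi>: "\<pi> permutes {1..n}" by simp
    have "tensor n ((\<lambda>l. matrix_unit (a l) (b l)) \<circ> \<pi>) i j
        = perm_tensor n \<pi> i a * perm_tensor n \<pi> j b"
      unfolding tensor_def matrix_unit_def perm_tensor_def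
      by (auto intro!: prod.neutral prod_zero)
    also have "\<dots> = of_bool (i = a \<circ> \<pi>) * of_bool (j = b \<circ> \<pi>)"
      using that assms \<pi> by (simp only: perm_tensor_on_tuples)
    moreover have "i = a \<circ> \<pi> \<longleftrightarrow> a = i \<circ> inv \<pi>" for i a :: "nat \<Rightarrow> 'N"
      using permutes_inv_o[OF \<pi>] by (metis comp_assoc comp_id)
    ultimately show ?thesis by (simp only: of_bool_conj)
  qed
  have "(\<Sum>(a, b)\<in>tuples n \<times> tuples n.
      K a b / fact n * sym_tensor n (\<lambda>l. matrix_unit (a l) (b l)) i j)
    = (\<Sum>p\<in>tuples n \<times> tuples n. \<Sum>\<pi>\<in>?P. K (fst p) (snd p) / fact n *
        tensor n ((\<lambda>l. matrix_unit (fst p l) (snd p l)) \<circ> \<pi>) i j)"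
    by (simp only: sym_tensor_def sum_distrib_left case_prod_unfold)
  also have "\<dots> = (\<Sum>p\<in>tuples n \<times> tuples n. \<Sum>\<pi>\<in>?P.
      if p = (i \<circ> inv \<pi>, j \<circ> inv \<pi>) then K (fst p) (snd p) / fact n else 0)"
  proof (intro sum.cong refl)
    fix p :: "(nat \<Rightarrow> 'N) \<times> (nat \<Rightarrow> 'N)" and \<pi> assume "p \<in> tuples n \<times> tuples n" "\<pi> \<in> ?P"
    then show "K (fst p) (snd p) / fact n *
        tensor n ((\<lambda>l. matrix_unit (fst p l) (snd p l)) \<circ> \<pi>) i j =
        (if p = (i \<circ> inv \<pi>, j \<circ> inv \<pi>) then K (fst p) (snd p) / fact n else 0)"
      by (subst eq) (auto simp: prod_eq_iff)
  qed
  also have "\<dots> = (\<Sum>\<pi>\<in>?P. \<Sum>p\<in>tuples n \<times> tuples n.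
      if p = (i \<circ> inv \<pi>, j \<circ> inv \<pi>) then K (fst p) (snd p) / fact n else 0)"
    by (rule sum.swap)
  also have "\<dots> = (\<Sum>\<pi>\<in>?P. K i j / fact n)"
  proof (intro sum.cong refl)
    fix \<pi> assume "\<pi> \<in> ?P"
    then have inv: "inv \<pi> permutes {1..n}" by (simp add: permutes_inv)
    have mem: "(i \<circ> inv \<pi>, j \<circ> inv \<pi>) \<in> tuples n \<times> tuples n"
      by (intro SigmaI tuples_comp[OF _ inv] assms(2,3))
    have fin: "finite (tuples n \<times> tuples n :: ((nat \<Rightarrow> 'N) \<times> (nat \<Rightarrow> 'N)) set)"
      by (intro finite_cartesian_product finite_tuples)
    show "(\<Sum>p\<in>tuples n \<times> tuples n.
        if p = (i \<circ> inv \<pi>, j \<circ> inv \<pi>) then K (fst p) (snd p) / fact n else 0) = K i j / fact n"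
      unfolding sum.delta[OF fin] using mem sym[OF inv assms(2,3)] by (simp del: mem_Sigma_iff)
  qed
  also have "\<dots> = K i j"
    by (simp add: card_permutations)
  finally show ?thesis .
qed

lemma commutes_with_symmetric_kernel:
  fixes W K :: "(nat \<Rightarrow> 'N::finite) \<Rightarrow> (nat \<Rightarrow> 'N) \<Rightarrow> complex"
  assumes "\<And>Y. commutes_with n W (tensor_deriv n Y)"
    and "\<And>\<pi> i j. \<pi> permutes {1..n} \<Longrightarrow> i \<in> tuples n \<Longrightarrow> j \<in> tuples n \<Longrightarrow>
      K (i \<circ> \<pi>) (j \<circ> \<pi>) = K i j"
  shows "commutes_with n W K"
proof -
  have "commutes_with n W (\<lambda>i j. \<Sum>p\<in>tuples n \<times> tuples n.
      K (fst p) (snd p) / fact n * sym_tensor n (\<lambda>l. matrix_unit (fst p l) (snd p l)) i j)"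
    by (intro commutes_with_sum commutes_with_sym_tensor assms(1))
  then show ?thesis
    by (rule commutes_with_cong)
       (use symmetric_kernel_expansion[of n K, OF assms(2)] in \<open>simp only: case_prod_unfold\<close>)
qed

section \<open>Infinitesimal unitary transformations\<close>

lemma tensor_power_has_vector_derivative:
  fixes U :: "real \<Rightarrow> complex ^ 'N::finite ^ 'N"
  assumes "U 0 = mat 1"
    and "\<And>a b. ((\<lambda>t. U t $ a $ b) has_vector_derivative Y $ a $ b) (at 0)"
  shows "((\<lambda>t. tensor n (\<lambda>_. U t) i j) has_vector_derivative tensor_deriv n Y i j) (at 0)"
proof -
  have "((\<lambda>t. \<Prod>k=1..n. U t $ i k $ j k) has_derivative
      (\<lambda>h. \<Sum>q=1..n. (h *\<^sub>R (Y $ i q $ j q)) * (\<Prod>k\<in>{1..n} - {q}. U 0 $ i k $ j k))) (at 0)"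
    by (rule has_derivative_prod) (use assms(2) in \<open>simp add: has_vector_derivative_def\<close>)
  then show ?thesis
    unfolding has_vector_derivative_def tensor_def[abs_def] tensor_deriv_alt
    by (simp add: assms(1) scaleR_sum_right)
qed

text \<open>Composing \<open>W\<close> with the curve on the left or on the right gives the same
  function of \<open>t\<close>; both derivatives at 0 can be taken entrywise and must agree.\<close>

lemma commutes_with_tensor_deriv_of_curve:
  fixes U :: "real \<Rightarrow> complex ^ 'N::finite ^ 'N"
  assumes "U 0 = mat 1"
    and "\<And>a b. ((\<lambda>t. U t $ a $ b) has_vector_derivative Y $ a $ b) (at 0)"
    and "\<And>t. commutes_with n W (tensor n (\<lambda>_. U t))"
  shows "commutes_with n W (tensor_deriv n Y)"
  unfolding commutes_with_def
proof (intro ballI)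
  fix i j :: "nat \<Rightarrow> 'N" assume ij: "i \<in> tuples n" "j \<in> tuples n"
  let ?T = "\<lambda>t. tensor n (\<lambda>_. U t)"
  note der = tensor_power_has_vector_derivative[where n = n, OF assms(1,2)]
  have "((\<lambda>t. kernel_comp n W (?T t) i j) has_vector_derivative kernel_comp n W (tensor_deriv n Y) i j) (at 0)"
    unfolding kernel_comp_def
    by (intro has_vector_derivative_sum has_vector_derivative_mult_right der)
  moreover have "((\<lambda>t. kernel_comp n (?T t) W i j) has_vector_derivative kernel_comp n (tensor_deriv n Y) W i j) (at 0)"
    unfolding kernel_comp_def
    by (intro has_vector_derivative_sum has_vector_derivative_mult_left der)
  moreover have "kernel_comp n W (?T t) i j = kernel_comp n (?T t) W i j" for t
    using assms(3)[of t] ij by (simp only: commutes_with_def)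
  ultimately show "kernel_comp n W (tensor_deriv n Y) i j = kernel_comp n (tensor_deriv n Y) W i j"
    by (simp only: vector_derivative_unique_at)
qed

section \<open>One-parameter families of unitary matrices\<close>

text \<open>Orthonormal rows suffice because a one-sided inverse of a square matrix is
  two-sided.\<close>

lemma unitary_groupI:
  assumes "\<And>x y. (\<Sum>z\<in>UNIV. U $ x $ z * cnj (U $ y $ z)) = of_bool (x = y)"
  shows "U \<in> unitary_group"
proof -
  have "U ** transpose (map_matrix cnj U) = mat 1"
    using assms by (simp add: vec_eq_iff matrix_matrix_mult_def transpose_def map_matrix_def mat_def)
  then show ?thesis
    unfolding unitary_group_def using matrix_left_right_inverse by blast
qed

lemma unitary_groupD:
  assumes "U \<in> unitary_group"
  shows "(\<Sum>z\<in>UNIV. U $ x $ z * cnj (U $ y $ z)) = of_bool (x = y)"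
proof -
  have "(U ** transpose (map_matrix cnj U)) $ x $ y = mat 1 $ x $ y"
    using assms by (simp add: unitary_group_def)
  then show ?thesis
    by (simp add: matrix_matrix_mult_def transpose_def map_matrix_def mat_def)
qed

text \<open>The exponential of \<open>t\<close> times \<i> E_aa, with E_aa the diagonal matrix unit
  at \<open>a\<close>.\<close>

definition phase_matrix :: "'N \<Rightarrow> real \<Rightarrow> complex ^ 'N ^ 'N" where
  "phase_matrix a t = (\<chi> x y. if x = y then (if x = a then cis t else 1) else 0)"

text \<open>For \<open>cmod \<omega> = 1\<close> and \<open>a \<noteq> b\<close> this is the
  exponential of \<open>t\<close> times Y = \<omega> E_ab - \<open>cnj \<omega>\<close> E_ba: the
  square of Y is minus the identity on the plane spanned by \<open>a\<close> and
  \<open>b\<close>.\<close>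

definition rotation_matrix :: "complex \<Rightarrow> 'N \<Rightarrow> 'N \<Rightarrow> real \<Rightarrow> complex ^ 'N ^ 'N" where
  "rotation_matrix \<omega> a b t = (\<chi> x y.
     if x = y then (if x = a \<or> x = b then of_real (cos t) else 1)
     else if x = a \<and> y = b then \<omega> * of_real (sin t)
     else if x = b \<and> y = a then - cnj \<omega> * of_real (sin t) else 0)"

lemma phase_matrix_unitary: "phase_matrix a t \<in> unitary_group"
proof (rule unitary_groupI)
  fix x y
  have "(\<Sum>z\<in>UNIV. phase_matrix a t $ x $ z * cnj (phase_matrix a t $ y $ z)) =
      (\<Sum>z\<in>UNIV. if z = x then phase_matrix a t $ x $ x * cnj (phase_matrix a t $ y $ x) else 0)"
    by (intro sum.cong) (auto simp: phase_matrix_def)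
  also have "\<dots> = phase_matrix a t $ x $ x * cnj (phase_matrix a t $ y $ x)" by simp
  also have "\<dots> = of_bool (x = y)"
    by (auto simp: phase_matrix_def cis_cnj cis_mult)
  finally show "(\<Sum>z\<in>UNIV. phase_matrix a t $ x $ z * cnj (phase_matrix a t $ y $ z)) = of_bool (x = y)" .
qed

lemma rotation_matrix_unitary:
  assumes "cmod \<omega> = 1" and "a \<noteq> b"
  shows "rotation_matrix \<omega> a b t \<in> unitary_group"
proof (rule unitary_groupI)
  fix x y
  let ?U = "rotation_matrix \<omega> a b t"
  have \<omega>: "\<omega> * cnj \<omega> = 1" using assms(1) by (simp flip: complex_norm_square)
  have sc: "of_real (sin t) * of_real (sin t) + of_real (cos t) * of_real (cos t) = (1 :: complex)"
    by (metis of_real_1 of_real_add of_real_mult power2_eq_square sin_cos_squared_add)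
  show "(\<Sum>z\<in>UNIV. ?U $ x $ z * cnj (?U $ y $ z)) = of_bool (x = y)"
  proof (cases "x = a \<or> x = b")
    case False
    then have "(\<Sum>z\<in>UNIV. ?U $ x $ z * cnj (?U $ y $ z)) =
        (\<Sum>z\<in>UNIV. if z = x then cnj (?U $ y $ x) else 0)"
      by (intro sum.cong) (auto simp: rotation_matrix_def)
    also have "\<dots> = of_bool (x = y)"
      using False by (auto simp: rotation_matrix_def)
    finally show ?thesis .
  next
    case True
    have "?U $ x $ z = 0" if "z \<notin> {a, b}" for z
      using True that by (auto simp: rotation_matrix_def)
    then have "(\<Sum>z\<in>UNIV. ?U $ x $ z * cnj (?U $ y $ z)) = (\<Sum>z\<in>{a, b}. ?U $ x $ z * cnj (?U $ y $ z))"
      by (intro sum.mono_neutral_right) simp_all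
    also have "\<dots> = ?U $ x $ a * cnj (?U $ y $ a) + ?U $ x $ b * cnj (?U $ y $ b)"
      using assms(2) by simp
    also have "\<dots> = of_bool (x = y)"
    proof -
      let ?c = "complex_of_real (cos t)" and ?s = "complex_of_real (sin t)"
      have "?c * ?c + \<omega> * ?s * (cnj \<omega> * ?s) = ?s * ?s * (\<omega> * cnj \<omega>) + ?c * ?c"
        "?c * ?c + cnj \<omega> * ?s * (\<omega> * ?s) = ?s * ?s * (\<omega> * cnj \<omega>) + ?c * ?c"
        by (simp_all only: ac_simps)
      then have "?c * ?c + \<omega> * ?s * (cnj \<omega> * ?s) = 1" "?c * ?c + cnj \<omega> * ?s * (\<omega> * ?s) = 1"
        by (simp_all only: \<omega> mult_1_right sc)
      then show ?thesis
        using True assms(2) by (cases "y = a"; cases "y = b") (auto simp: rotation_matrix_def add.commute)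
    qed
    finally show ?thesis .
  qed
qed

text \<open>Differentiating the tensor powers of one-parameter families of unitary matrices yields the
  skew-Hermitian matrices, whose complex span is everything.\<close>

lemma commutes_with_tensor_deriv:
  fixes W :: "(nat \<Rightarrow> 'N::finite) \<Rightarrow> (nat \<Rightarrow> 'N) \<Rightarrow> complex"
  assumes unitary: "\<And>U. U \<in> unitary_group \<Longrightarrow> commutes_with n W (tensor n (\<lambda>_. U))"
  shows "commutes_with n W (tensor_deriv n Y)"
proof -
  have diag: "commutes_with n W (tensor_deriv n (\<chi> x y. \<i> * of_bool (x = a \<and> y = a)))" for a
  proof (rule commutes_with_tensor_deriv_of_curve[of "phase_matrix a"])
    show "phase_matrix a 0 = mat 1" by (simp add: phase_matrix_def mat_def vec_eq_iff)
    fix x y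
    have "((\<lambda>t. exp (\<i> * complex_of_real t)) has_vector_derivative \<i>) (at 0)"
      by (rule has_vector_derivative_real_field) (auto intro!: derivative_eq_intros)
    then have "(cis has_vector_derivative \<i>) (at 0)"
      by (simp add: cis_conv_exp[abs_def])
    then show "((\<lambda>t. phase_matrix a t $ x $ y) has_vector_derivative
        (\<chi> x y. \<i> * of_bool (x = a \<and> y = a)) $ x $ y) (at 0)"
      by (cases "x = y"; cases "x = a") (simp_all add: phase_matrix_def)
  qed (intro unitary phase_matrix_unitary)
  have off: "commutes_with n W (tensor_deriv n
      (\<chi> x y. \<omega> * of_bool (x = a \<and> y = b) - cnj \<omega> * of_bool (x = b \<and> y = a)))"
    if "cmod \<omega> = 1" "a \<noteq> b" for \<omega> a b
  proof (rule commutes_with_tensor_deriv_of_curve[of "rotation_matrix \<omega> a b"])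
    show "rotation_matrix \<omega> a b 0 = mat 1"
      by (auto simp: rotation_matrix_def mat_def vec_eq_iff)
    fix x y
    have "((\<lambda>t. c * complex_of_real (sin t)) has_vector_derivative c * of_real 1) (at 0)" for c
      by (intro has_vector_derivative_mult_right has_vector_derivative_of_real)
         (auto intro!: derivative_eq_intros)
    moreover from has_vector_derivative_minus[OF this]
    have "((\<lambda>t. - (c * complex_of_real (sin t))) has_vector_derivative - c) (at 0)" for c
      by simp
    moreover have "((\<lambda>t. complex_of_real (cos t)) has_vector_derivative of_real 0) (at 0)"
      by (intro has_vector_derivative_of_real) (auto intro!: derivative_eq_intros)
    ultimately show "((\<lambda>t. rotation_matrix \<omega> a b t $ x $ y) has_vector_derivative
        (\<chi> x y. \<omega> * of_bool (x = a \<and> y = b) - cnj \<omega> * of_bool (x = b \<and> y = a)) $ x $ y) (at 0)"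
      using that(2)
      by (cases "x = y"; cases "x = a"; cases "x = b"; cases "y = a"; cases "y = b")
         (simp_all add: rotation_matrix_def)
  qed (intro unitary rotation_matrix_unitary that)
  have unit: "commutes_with n W (tensor_deriv n (matrix_unit a b))" for a b
  proof (cases "a = b")
    case True
    \<comment> \<open>A sum over one element, so that closure under linear combinations covers a
      scalar multiple.\<close>
    have "commutes_with n W (\<lambda>i j. \<Sum>u\<in>{()}. - \<i> * tensor_deriv n (\<chi> x y. \<i> * of_bool (x = a \<and> y = a)) i j)"
      by (intro commutes_with_sum diag)
    then show ?thesis
    proof (rule commutes_with_cong)
      fix i j
      have "- \<i> * tensor_deriv n (\<chi> x y. \<i> * of_bool (x = a \<and> y = a)) i j = tensor_deriv n (matrix_unit a a) i j"
        unfolding tensor_deriv_alt sum_distrib_left matrix_unit_def by (intro sum.cong refl) simp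
      then show "(\<Sum>u\<in>{()}. - \<i> * tensor_deriv n (\<chi> x y. \<i> * of_bool (x = a \<and> y = a)) i j) =
          tensor_deriv n (matrix_unit a b) i j"
        by (simp add: True)
    qed
  next
    case False
    let ?Y = "\<lambda>\<omega>. \<chi> x y. \<omega> * of_bool (x = a \<and> y = b) - cnj \<omega> * of_bool (x = b \<and> y = a)"
    \<comment> \<open>For \<omega> = 1 and \<omega> = \<i> the directions are E_ab - E_ba and \<i>
      (E_ab + E_ba). With weights 1/2 and 1/(2\<i>) the E_ba parts cancel.\<close>
    have "commutes_with n W (\<lambda>i j. \<Sum>\<omega>\<in>{1, \<i>}. (1 / (2 * \<omega>)) * tensor_deriv n (?Y \<omega>) i j)"
      by (intro commutes_with_sum off[OF _ False]) auto
    then show ?thesis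
    proof (rule commutes_with_cong)
      fix i j
      have scalar: "1 / (2 * 1) * ((1 * u - cnj 1 * w) * d) + 1 / (2 * \<i>) * ((\<i> * u - cnj \<i> * w) * d) = u * d"
        for u w d :: complex
        by (simp add: field_simps)
      have "(1 :: complex) \<noteq> \<i>" by (simp add: complex_eq_iff)
      then have "(\<Sum>\<omega>\<in>{1, \<i>}. (1 / (2 * \<omega>)) * tensor_deriv n (?Y \<omega>) i j) =
            1 / (2 * 1) * tensor_deriv n (?Y 1) i j + 1 / (2 * \<i>) * tensor_deriv n (?Y \<i>) i j"
        by simp
      also have "\<dots> = tensor_deriv n (matrix_unit a b) i j"
        unfolding tensor_deriv_alt sum_distrib_left sum.distrib[symmetric]
      proof (intro sum.cong refl)
        fix q
        show "1 / (2 * 1) * (?Y 1 $ i q $ j q * (\<Prod>k\<in>{1..n} - {q}. mat 1 $ i k $ j k)) +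
            1 / (2 * \<i>) * (?Y \<i> $ i q $ j q * (\<Prod>k\<in>{1..n} - {q}. mat 1 $ i k $ j k)) =
            matrix_unit a b $ i q $ j q * (\<Prod>k\<in>{1..n} - {q}. mat 1 $ i k $ j k)"
          unfolding matrix_unit_def vec_lambda_beta by (rule scalar)
      qed
      finally show "(\<Sum>\<omega>\<in>{1, \<i>}. (1 / (2 * \<omega>)) * tensor_deriv n (?Y \<omega>) i j) =
        tensor_deriv n (matrix_unit a b) i j" .
    qed
  qed
  have "commutes_with n W (\<lambda>i j. \<Sum>p\<in>UNIV. Y $ fst p $ snd p * tensor_deriv n (matrix_unit (fst p) (snd p)) i j)"
    by (intro commutes_with_sum unit)
  then show ?thesis
  proof (rule commutes_with_cong)
    fix i j :: "nat \<Rightarrow> 'N"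
    let ?d = "\<lambda>q. \<Prod>k\<in>{1..n} - {q}. (mat 1 :: complex ^ 'N ^ 'N) $ i k $ j k"
    have "(\<Sum>p\<in>UNIV. Y $ fst p $ snd p * tensor_deriv n (matrix_unit (fst p) (snd p)) i j) =
        (\<Sum>q=1..n. \<Sum>p\<in>UNIV. Y $ fst p $ snd p * (matrix_unit (fst p) (snd p) $ i q $ j q * ?d q))"
      unfolding tensor_deriv_alt sum_distrib_left by (rule sum.swap)
    also have "\<dots> = (\<Sum>q=1..n. \<Sum>p\<in>UNIV. if p = (i q, j q) then Y $ i q $ j q * ?d q else 0)"
      by (intro sum.cong refl) (auto simp: matrix_unit_def prod_eq_iff)
    also have "\<dots> = tensor_deriv n Y i j"
      unfolding tensor_deriv_alt by simp
    finally show "(\<Sum>p\<in>UNIV. Y $ fst p $ snd p * tensor_deriv n (matrix_unit (fst p) (snd p)) i j) =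
      tensor_deriv n Y i j" .
  qed
qed

section \<open>Schur--Weyl duality\<close>

lemma sum_perm_tensors_in_span:
  fixes C :: "'a \<Rightarrow> complex"
  assumes "\<And>x. x \<in> A \<Longrightarrow> p x permutes {1..n}"
  shows "\<exists>c. \<forall>(i :: nat \<Rightarrow> 'N::finite) i'. (\<Sum>x\<in>A. C x * perm_tensor n (p x) i i') =
    (\<Sum>\<sigma>\<in>perms_no_decreasing CARD('N) n. c \<sigma> * perm_tensor n \<sigma> i i')"
proof -
  let ?S = "perms_no_decreasing CARD('N) n"
  have "\<forall>x\<in>A. \<exists>c. \<forall>(i :: nat \<Rightarrow> 'N) i'.
      perm_tensor n (p x) i i' = (\<Sum>\<sigma>\<in>?S. c \<sigma> * perm_tensor n \<sigma> i i')"
    using perm_tensor_in_span assms by blast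
  from bchoice[OF this] obtain d where d: "\<And>x (i :: nat \<Rightarrow> 'N) i'. x \<in> A \<Longrightarrow>
      perm_tensor n (p x) i i' = (\<Sum>\<sigma>\<in>?S. d x \<sigma> * perm_tensor n \<sigma> i i')" by blast
  show ?thesis
  proof (intro exI[of _ "\<lambda>\<sigma>. \<Sum>x\<in>A. C x * d x \<sigma>"] allI)
    fix i i' :: "nat \<Rightarrow> 'N"
    have "(\<Sum>x\<in>A. C x * perm_tensor n (p x) i i') =
        (\<Sum>x\<in>A. C x * (\<Sum>\<sigma>\<in>?S. d x \<sigma> * perm_tensor n \<sigma> i i'))"
      by (intro sum.cong refl) (simp only: d)
    also have "\<dots> = (\<Sum>\<sigma>\<in>?S. (\<Sum>x\<in>A. C x * d x \<sigma>) * perm_tensor n \<sigma> i i')"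
      unfolding sum_distrib_left sum_distrib_right by (subst sum.swap) (simp only: mult.assoc)
    finally show "(\<Sum>x\<in>A. C x * perm_tensor n (p x) i i') =
        (\<Sum>\<sigma>\<in>?S. (\<Sum>x\<in>A. C x * d x \<sigma>) * perm_tensor n \<sigma> i i')" .
  qed
qed

lemma is_inverse_onD:
  assumes "is_inverse_on S A B" and "x \<in> S" and "y \<in> S"
  shows "(\<Sum>z\<in>S. A x z * B z y) = of_bool (x = y)" and "(\<Sum>z\<in>S. B x z * A z y) = of_bool (x = y)"
  using assms unfolding is_inverse_on_def by blast+

text \<open>The orthogonal projection onto the span of the permutation tensors, acting on kernels:
  it takes entries indexed by \<open>(k, k')\<close> to entries indexed by
  \<open>(i, i')\<close>.\<close>

definition gram_projection ::
  "nat \<Rightarrow> (nat \<Rightarrow> 'N::finite) \<Rightarrow> (nat \<Rightarrow> 'N) \<Rightarrow> (nat \<Rightarrow> 'N) \<Rightarrow> (nat \<Rightarrow> 'N) \<Rightarrow> complex" where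
  "gram_projection n i i' k k' =
     (\<Sum>\<sigma>\<in>perms_no_decreasing CARD('N) n. \<Sum>\<tau>\<in>perms_no_decreasing CARD('N) n.
        inverse_on (perms_no_decreasing CARD('N) n) (gram_matrix CARD('N) n) \<sigma> \<tau> *
        perm_tensor n \<tau> k k' * perm_tensor n \<sigma> i i')"

text \<open>\<open>\<rho>\<close> may lie outside the basis. Its expansion with coefficients
  \<open>d\<close> pairs with the basis to the Gram matrix times \<open>d\<close>, and the inverse
  Gram matrix recovers \<open>d\<close>.\<close>

lemma gram_projection_perm_tensor:
  assumes "\<rho> permutes {1..n}"
  shows "(\<Sum>k\<in>tuples n. \<Sum>k'\<in>tuples n.
      gram_projection n i i' k k' * perm_tensor n \<rho> k (k' :: nat \<Rightarrow> 'N::finite)) = perm_tensor n \<rho> i i'"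
proof -
  let ?S = "perms_no_decreasing CARD('N) n"
  let ?G = "gram_matrix CARD('N) n"
  let ?B = "inverse_on ?S ?G"
  let ?X = "tuples n \<times> tuples n :: ((nat \<Rightarrow> 'N) \<times> (nat \<Rightarrow> 'N)) set"
  let ?v = "\<lambda>\<sigma> (p :: (nat \<Rightarrow> 'N) \<times> (nat \<Rightarrow> 'N)). perm_tensor n \<sigma> (fst p) (snd p)"
  note inv = is_inverse_onD[OF is_inverse_on_inverse_on[OF gram_matrix_invertible[where 'N='N, of n]]]
  obtain d where d: "\<And>(i :: nat \<Rightarrow> 'N) i'.
      perm_tensor n \<rho> i i' = (\<Sum>\<mu>\<in>?S. d \<mu> * perm_tensor n \<mu> i i')"
    using perm_tensor_in_span[OF assms] by blast
  have gram: "(\<Sum>p\<in>?X. ?v \<tau> p * ?v \<rho> p) = (\<Sum>\<mu>\<in>?S. ?G \<tau> \<mu> * d \<mu>)" if "\<tau> \<in> ?S" for \<tau>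
  proof -
    have "(\<Sum>p\<in>?X. ?v \<tau> p * ?v \<rho> p) = (\<Sum>\<mu>\<in>?S. (\<Sum>p\<in>?X. ?v \<tau> p * ?v \<mu> p) * d \<mu>)"
      unfolding d sum_distrib_left sum_distrib_right by (subst sum.swap) (simp only: mult_ac)
    also have "\<dots> = (\<Sum>\<mu>\<in>?S. ?G \<tau> \<mu> * d \<mu>)"
    proof (intro sum.cong refl)
      fix \<mu> assume "\<mu> \<in> ?S"
      then show "(\<Sum>p\<in>?X. ?v \<tau> p * ?v \<mu> p) * d \<mu> = ?G \<tau> \<mu> * d \<mu>"
        using perm_tensor_gram[where 'N='N, of \<tau> n \<mu>] that perms_no_decreasing_permutes
        by (simp only: sum.cartesian_product case_prod_unfold)
    qed
    finally show ?thesis .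
  qed
  have "(\<Sum>k\<in>tuples n. \<Sum>k'\<in>tuples n. gram_projection n i i' k k' * perm_tensor n \<rho> k k') =
      (\<Sum>p\<in>?X. gram_projection n i i' (fst p) (snd p) * ?v \<rho> p)"
    by (simp only: sum.cartesian_product case_prod_unfold)
  also have "\<dots> = (\<Sum>p\<in>?X. \<Sum>\<sigma>\<in>?S. \<Sum>\<tau>\<in>?S. ?B \<sigma> \<tau> * (?v \<tau> p * ?v \<rho> p) * perm_tensor n \<sigma> i i')"
    unfolding gram_projection_def sum_distrib_right by (simp only: mult_ac)
  also have "\<dots> = (\<Sum>\<sigma>\<in>?S. \<Sum>p\<in>?X. \<Sum>\<tau>\<in>?S. ?B \<sigma> \<tau> * (?v \<tau> p * ?v \<rho> p) * perm_tensor n \<sigma> i i')"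
    by (rule sum.swap)
  also have "\<dots> = (\<Sum>\<sigma>\<in>?S. \<Sum>\<tau>\<in>?S. \<Sum>p\<in>?X. ?B \<sigma> \<tau> * (?v \<tau> p * ?v \<rho> p) * perm_tensor n \<sigma> i i')"
    by (rule sum.cong[OF refl], rule sum.swap)
  also have "\<dots> = (\<Sum>\<sigma>\<in>?S. (\<Sum>\<tau>\<in>?S. ?B \<sigma> \<tau> * (\<Sum>p\<in>?X. ?v \<tau> p * ?v \<rho> p)) * perm_tensor n \<sigma> i i')"
    by (simp only: sum_distrib_left sum_distrib_right)
  also have "\<dots> = (\<Sum>\<sigma>\<in>?S. d \<sigma> * perm_tensor n \<sigma> i i')"
  proof (rule sum.cong[OF refl])
    fix \<sigma> assume \<sigma>: "\<sigma> \<in> ?S"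
    have "(\<Sum>\<tau>\<in>?S. ?B \<sigma> \<tau> * (\<Sum>p\<in>?X. ?v \<tau> p * ?v \<rho> p)) =
        (\<Sum>\<tau>\<in>?S. ?B \<sigma> \<tau> * (\<Sum>\<mu>\<in>?S. ?G \<tau> \<mu> * d \<mu>))"
      by (intro sum.cong refl) (simp only: gram)
    also have "\<dots> = (\<Sum>\<mu>\<in>?S. (\<Sum>\<tau>\<in>?S. ?B \<sigma> \<tau> * ?G \<tau> \<mu>) * d \<mu>)"
      unfolding sum_distrib_left sum_distrib_right by (subst sum.swap) (simp only: mult_ac)
    also have "\<dots> = (\<Sum>\<mu>\<in>?S. if \<sigma> = \<mu> then d \<mu> else 0)"
      by (intro sum.cong refl) (simp add: inv(2)[OF \<sigma>])
    also have "\<dots> = d \<sigma>" using \<sigma> finite_perms_no_decreasing by simp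
    finally show "(\<Sum>\<tau>\<in>?S. ?B \<sigma> \<tau> * (\<Sum>p\<in>?X. ?v \<tau> p * ?v \<rho> p)) * perm_tensor n \<sigma> i i' =
        d \<sigma> * perm_tensor n \<sigma> i i'" by simp
  qed
  finally show ?thesis unfolding d .
qed

text \<open>Schur--Weyl duality. Averaging the projection onto the span of the permutations over the
  symmetric group makes each of its blocks (fixed \<open>i'\<close> and \<open>k'\<close>) a symmetric kernel, which commutes
  with \<open>W\<close>. So the averaged projection \<open>P\<close> satisfies \<open>P W = W (P 1) = W\<close>.\<close>

lemma commutant_in_span:
  fixes W :: "(nat \<Rightarrow> 'N::finite) \<Rightarrow> (nat \<Rightarrow> 'N) \<Rightarrow> complex"
  assumes unitary: "\<And>U. U \<in> unitary_group \<Longrightarrow> commutes_with n W (tensor n (\<lambda>_. U))"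
  shows "\<exists>c. \<forall>i\<in>tuples n. \<forall>i'\<in>tuples n.
    W i i' = (\<Sum>\<sigma>\<in>perms_no_decreasing CARD('N) n. c \<sigma> * perm_tensor n \<sigma> i i')"
proof -
  let ?S = "perms_no_decreasing CARD('N) n"
  let ?B = "inverse_on ?S (gram_matrix CARD('N) n)"
  let ?P = "{\<pi>. \<pi> permutes {1..n}}"
  let ?R = "gram_projection n :: (nat \<Rightarrow> 'N) \<Rightarrow> _"
  define P where "P = (\<lambda>(i :: nat \<Rightarrow> 'N) i' k k'. (\<Sum>\<pi>\<in>?P. ?R (i \<circ> \<pi>) i' (k \<circ> \<pi>) k') / fact n)"
  have sym: "P (i \<circ> \<rho>) i' (k \<circ> \<rho>) k' = P i i' k k'" if "\<rho> permutes {1..n}" for \<rho> i i' k k'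
    unfolding P_def comp_assoc
    by (rule arg_cong[where f = "\<lambda>x. x / fact n"],
        rule setum_permutations_compose_left[OF that, symmetric])
  have comm: "kernel_comp n W (\<lambda>i k. P i i' k k') a b = kernel_comp n (\<lambda>i k. P i i' k k') W a b"
    if "a \<in> tuples n" "b \<in> tuples n" for i' k' a b
    using commutes_with_symmetric_kernel[OF commutes_with_tensor_deriv[OF unitary],
        where K = "\<lambda>i k. P i i' k k'"] sym that
    unfolding commutes_with_def by blast
  have P_id: "(\<Sum>k'\<in>tuples n. P i i' k' k') = of_bool (i = i')"
    if "i \<in> tuples n" "i' \<in> tuples n" for i i'
  proof -
    \<comment> \<open>The left side is the projection applied to the tensor of \<open>\<pi>\<close>,
      read at \<open>(i \<circ> \<pi>, i')\<close>. That tensor is fixed, and the shift of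
      \<open>i\<close> by \<open>\<pi>\<close> turns it into the identity.\<close>
    have id_term: "(\<Sum>k'\<in>tuples n. ?R (i \<circ> \<pi>) i' (k' \<circ> \<pi>) k') = of_bool (i = i')" if "\<pi> \<in> ?P" for \<pi>
    proof -
      from that have \<pi>: "\<pi> permutes {1..n}" by simp
      have "(\<Sum>k'\<in>tuples n. ?R (i \<circ> \<pi>) i' (k' \<circ> \<pi>) k') =
          (\<Sum>k'\<in>tuples n. \<Sum>k\<in>tuples n. perm_tensor n \<pi> k k' * ?R (i \<circ> \<pi>) i' k k')"
        by (intro sum.cong refl) (simp only: sum_perm_tensor_left[OF \<pi>])
      also have "\<dots> = (\<Sum>k\<in>tuples n. \<Sum>k'\<in>tuples n. ?R (i \<circ> \<pi>) i' k k' * perm_tensor n \<pi> k k')"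
        by (subst sum.swap) (simp only: mult.commute)
      also have "\<dots> = perm_tensor n \<pi> (i \<circ> \<pi>) i'"
        by (rule gram_projection_perm_tensor[OF \<pi>])
      also have "\<dots> = perm_tensor n id i i'"
        unfolding perm_tensor_comp[OF \<pi>] permutes_inv_o(1)[OF \<pi>] ..
      also have "\<dots> = of_bool (i = i')"
        using perm_tensor_on_tuples[OF \<open>i \<in> tuples n\<close> \<open>i' \<in> tuples n\<close> permutes_id] by simp
      finally show ?thesis .
    qed
    have "(\<Sum>k'\<in>tuples n. P i i' k' k') = (\<Sum>\<pi>\<in>?P. \<Sum>k'\<in>tuples n. ?R (i \<circ> \<pi>) i' (k' \<circ> \<pi>) k') / fact n"
      unfolding P_def sum_divide_distrib[symmetric] by (subst sum.swap) (rule refl)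
    also have "\<dots> = (\<Sum>\<pi>\<in>?P. of_bool (i = i')) / fact n"
      by (intro arg_cong[where f = "\<lambda>x. x / fact n"] sum.cong refl id_term)
    also have "\<dots> = of_bool (i = i')"
      by (simp add: card_permutations)
    finally show ?thesis .
  qed
  have W_eq: "W i i' = (\<Sum>k\<in>tuples n. \<Sum>k'\<in>tuples n. P i i' k k' * W k k')"
    if i: "i \<in> tuples n" and i': "i' \<in> tuples n" for i i'
  proof -
    have "(\<Sum>k\<in>tuples n. \<Sum>k'\<in>tuples n. P i i' k k' * W k k') =
        (\<Sum>k'\<in>tuples n. \<Sum>k\<in>tuples n. P i i' k k' * W k k')"
      by (rule sum.swap)
    \<comment> \<open>For fixed \<open>i'\<close> and \<open>k'\<close> the inner sum is entry
      \<open>(i, k')\<close> of a block of \<open>P\<close> composed with \<open>W\<close>;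
      exchanging the two leaves \<open>P\<close> to act on the identity kernel.\<close>
    also have "\<dots> = (\<Sum>k'\<in>tuples n. \<Sum>k\<in>tuples n. W i k * P k i' k' k')"
      by (intro sum.cong[OF refl] comm[OF i, unfolded kernel_comp_def, symmetric])
    also have "\<dots> = (\<Sum>k\<in>tuples n. W i k * (\<Sum>k'\<in>tuples n. P k i' k' k'))"
      by (subst sum.swap) (simp only: sum_distrib_left)
    also have "\<dots> = (\<Sum>k\<in>tuples n. W i k * of_bool (k = i'))"
      by (intro sum.cong refl) (simp only: P_id i')
    also have "\<dots> = (\<Sum>k\<in>tuples n. if k = i' then W i k else 0)"
      by (intro sum.cong refl) simp
    also have "\<dots> = W i i'"
      using i' finite_tuples[where 'a='N, of n] by (simp only: sum.delta if_True)
    finally show ?thesis ..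
  qed
  let ?X = "tuples n \<times> tuples n :: ((nat \<Rightarrow> 'N) \<times> (nat \<Rightarrow> 'N)) set"
  let ?b = "\<lambda>x k k'. (\<Sum>\<tau>\<in>?S. ?B (snd x) \<tau> * perm_tensor n \<tau> (k \<circ> fst x) k') / fact n"
  \<comment> \<open>As a function of \<open>(i, i')\<close>, \<open>P\<close> combines tensors of
    \<open>\<sigma> \<circ> inv \<pi>\<close>. These may leave the basis, so spanning is used once
    more below.\<close>
  have P_eq: "P i i' k k' = (\<Sum>x\<in>?P \<times> ?S. ?b x k k' * perm_tensor n (snd x \<circ> inv (fst x)) i i')"
    for i i' k k'
  proof -
    have "P i i' k k' = (\<Sum>\<pi>\<in>?P. \<Sum>\<sigma>\<in>?S. ?b (\<pi>, \<sigma>) k k' * perm_tensor n \<sigma> (i \<circ> \<pi>) i')"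
      unfolding P_def gram_projection_def sum_divide_distrib sum_distrib_right by simp
    also have "\<dots> = (\<Sum>\<pi>\<in>?P. \<Sum>\<sigma>\<in>?S. ?b (\<pi>, \<sigma>) k k' * perm_tensor n (\<sigma> \<circ> inv \<pi>) i i')"
      by (intro sum.cong refl) (simp only: mem_Collect_eq perm_tensor_comp)
    also have "\<dots> = (\<Sum>x\<in>?P \<times> ?S. ?b x k k' * perm_tensor n (snd x \<circ> inv (fst x)) i i')"
      by (simp only: sum.cartesian_product case_prod_unfold prod.collapse fst_conv snd_conv)
    finally show ?thesis .
  qed
  define C where "C = (\<lambda>x. \<Sum>p\<in>?X. ?b x (fst p) (snd p) * W (fst p) (snd p))"
  have expand: "(\<Sum>k\<in>tuples n. \<Sum>k'\<in>tuples n. P i i' k k' * W k k') =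
      (\<Sum>x\<in>?P \<times> ?S. C x * perm_tensor n (snd x \<circ> inv (fst x)) i i')" for i i'
  proof -
    let ?w = "\<lambda>x. perm_tensor n (snd x \<circ> inv (fst x)) i i'"
    have "(\<Sum>k\<in>tuples n. \<Sum>k'\<in>tuples n. P i i' k k' * W k k') =
        (\<Sum>p\<in>?X. P i i' (fst p) (snd p) * W (fst p) (snd p))"
      by (simp only: sum.cartesian_product case_prod_unfold)
    also have "\<dots> = (\<Sum>p\<in>?X. \<Sum>x\<in>?P \<times> ?S. ?b x (fst p) (snd p) * ?w x * W (fst p) (snd p))"
      unfolding P_eq sum_distrib_right ..
    also have "\<dots> = (\<Sum>x\<in>?P \<times> ?S. \<Sum>p\<in>?X. ?b x (fst p) (snd p) * ?w x * W (fst p) (snd p))"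
      by (rule sum.swap)
    also have "\<dots> = (\<Sum>x\<in>?P \<times> ?S. \<Sum>p\<in>?X. ?b x (fst p) (snd p) * W (fst p) (snd p) * ?w x)"
      by (intro sum.cong refl) (simp only: mult_ac)
    also have "\<dots> = (\<Sum>x\<in>?P \<times> ?S. C x * ?w x)"
      unfolding C_def by (rule sum.cong[OF refl], rule sum_distrib_right[symmetric])
    finally show ?thesis .
  qed
  have "\<exists>c. \<forall>i i' :: nat \<Rightarrow> 'N. (\<Sum>x\<in>?P \<times> ?S. C x * perm_tensor n (snd x \<circ> inv (fst x)) i i') =
      (\<Sum>\<sigma>\<in>?S. c \<sigma> * perm_tensor n \<sigma> i i')"
  proof (rule sum_perm_tensors_in_span)
    fix x assume "x \<in> ?P \<times> ?S"
    then have "fst x permutes {1..n}" and "snd x \<in> ?S" by auto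
    from permutes_compose[OF permutes_inv[OF this(1)] perms_no_decreasing_permutes[OF this(2)]]
    show "snd x \<circ> inv (fst x) permutes {1..n}" .
  qed
  then obtain c where c: "\<And>i i' :: nat \<Rightarrow> 'N.
      (\<Sum>x\<in>?P \<times> ?S. C x * perm_tensor n (snd x \<circ> inv (fst x)) i i') =
      (\<Sum>\<sigma>\<in>?S. c \<sigma> * perm_tensor n \<sigma> i i')" by blast
  show ?thesis
    using trans[OF W_eq trans[OF expand c]] by (intro exI[of _ c] ballI)
qed

section \<open>Moments of Haar unitary matrices\<close>

lemma unitary_group_mult:
  assumes "V \<in> unitary_group" and "U \<in> unitary_group"
  shows "V ** U \<in> unitary_group"
proof -
  have "map_matrix cnj (V ** U) = map_matrix cnj V ** map_matrix cnj U"
    by (simp add: vec_eq_iff map_matrix_def matrix_matrix_mult_def)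
  then have adj: "transpose (map_matrix cnj (V ** U)) =
      transpose (map_matrix cnj U) ** transpose (map_matrix cnj V)"
    by (simp add: matrix_transpose_mul)
  have "V ** U ** (transpose (map_matrix cnj U) ** transpose (map_matrix cnj V)) =
      V ** (U ** transpose (map_matrix cnj U)) ** transpose (map_matrix cnj V)"
    by (simp only: matrix_mul_assoc)
  also have "\<dots> = mat 1"
    using assms by (simp add: unitary_group_def)
  finally have "V ** U ** transpose (map_matrix cnj (V ** U)) = mat 1"
    unfolding adj .
  moreover from this have "transpose (map_matrix cnj (V ** U)) ** (V ** U) = mat 1"
    by (rule matrix_left_right_inverse[THEN iffD1])
  ultimately show ?thesis
    unfolding unitary_group_def by (intro CollectI conjI)
qed

lemma unitary_entry_bound:
  fixes U :: "complex ^ 'N::finite ^ 'N"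
  assumes "U \<in> unitary_group"
  shows "cmod (U $ a $ b) \<le> 1"
proof -
  have "complex_of_real (\<Sum>z\<in>UNIV. (cmod (U $ a $ z))\<^sup>2) = 1"
    using unitary_groupD[OF assms, of a a] by (simp only: of_real_sum complex_norm_square) simp
  then have "(\<Sum>z\<in>UNIV. (cmod (U $ a $ z))\<^sup>2) = 1"
    by (simp only: of_real_eq_1_iff)
  moreover have "(cmod (U $ a $ b))\<^sup>2 \<le> (\<Sum>z\<in>UNIV. (cmod (U $ a $ z))\<^sup>2)"
    by (rule member_le_sum) auto
  ultimately show ?thesis by (simp add: power_le_one_iff)
qed

lemma tensor_unitary_orthonormal:
  assumes "U \<in> unitary_group" and "j \<in> tuples n" and "m \<in> tuples n"
  shows "(\<Sum>i\<in>tuples n. cnj (tensor n (\<lambda>_. U) i j) * tensor n (\<lambda>_. U) i m) = of_bool (j = m)"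
proof -
  have "(\<Sum>i\<in>tuples n. cnj (tensor n (\<lambda>_. U) i j) * tensor n (\<lambda>_. U) i m) =
      kernel_comp n (tensor n (\<lambda>_. transpose (map_matrix cnj U))) (tensor n (\<lambda>_. U)) j m"
    unfolding kernel_comp_def tensor_def by (simp add: transpose_def map_matrix_def)
  also have "\<dots> = tensor n (\<lambda>_. mat 1) j m"
    using assms(1) by (simp only: kernel_comp_tensor unitary_group_def mem_Collect_eq)
  also have "\<dots> = of_bool (j = m)" by (rule tensor_mat_1[OF assms(2,3)])
  finally show ?thesis .
qed

text \<open>All slots carry the same \<open>U\<close>, so permuting both indices together only
  reorders the factors.\<close>

lemma tensor_permute:
  assumes "\<pi> permutes {1..n}"
  shows "tensor n (\<lambda>_. U) (i \<circ> \<pi>) j = tensor n (\<lambda>_. U) i (j \<circ> inv \<pi>)"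
proof -
  have "(\<Prod>k=1..n. U $ i (\<pi> k) $ j (inv \<pi> (\<pi> k))) = (\<Prod>k=1..n. U $ i k $ j (inv \<pi> k))"
    by (rule prod.reindex_bij_betw[OF permutes_imp_bij[OF assms]])
  then show ?thesis
    unfolding tensor_def by (simp add: permutes_inverses[OF assms])
qed

lemma continuous_on_tensor: "continuous_on UNIV (\<lambda>U :: complex ^ 'N::finite ^ 'N. tensor n (\<lambda>_. U) i j)"
  unfolding tensor_def by (intro continuous_intros)

text \<open>The column indices come first so that fixing them leaves a kernel in \<open>i\<close>
  and \<open>i'\<close>, the operator to which duality is applied.\<close>

definition haar_moment ::
  "(complex ^ 'N ^ 'N) measure \<Rightarrow> nat \<Rightarrow> (nat \<Rightarrow> 'N) \<Rightarrow> (nat \<Rightarrow> 'N) \<Rightarrow> (nat \<Rightarrow> 'N) \<Rightarrow> (nat \<Rightarrow> 'N) \<Rightarrow> complex" where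
  "haar_moment M n j j' i i' = (LINT U|M. tensor n (\<lambda>_. U) i j * cnj (tensor n (\<lambda>_. U) i' j'))"

section \<open>Integration against a Haar measure\<close>

context
  fixes M :: "(complex ^ 'N::finite ^ 'N) measure"
  assumes haar: "haar_unitary M"
begin

lemma haar_sets: "sets M = sets (restrict_space borel unitary_group)"
  using haar by (simp add: haar_unitary_def)

lemma haar_space: "space M = unitary_group"
  using sets_eq_imp_space_eq[OF haar_sets] by (simp add: space_restrict_space)

lemma haar_measurable:
  fixes f :: "complex ^ 'N ^ 'N \<Rightarrow> 'b::topological_space"
  assumes "continuous_on UNIV f"
  shows "f \<in> borel_measurable M"
proof -
  have "f \<in> borel_measurable (restrict_space borel unitary_group)"
    by (intro measurable_restrict_space1 borel_measurable_continuous_onI assms)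
  then show ?thesis
    by (simp add: measurable_cong_sets[OF haar_sets refl])
qed

text \<open>Rows of a unitary matrix are unit vectors, so all entries and their products have
  modulus at most 1, and the measure is finite.\<close>

lemma integrable_haar_tensor:
  "integrable M (\<lambda>U. tensor n (\<lambda>_. U) i j * cnj (tensor n (\<lambda>_. U) i' j'))"
proof -
  interpret prob_space M using haar by (simp add: haar_unitary_def)
  have bound: "cmod (tensor n (\<lambda>_. U) i j) \<le> 1" if "U \<in> unitary_group" for U :: "complex ^ 'N ^ 'N" and i j
    unfolding tensor_def prod_norm[symmetric]
    by (intro prod_le_1) (simp add: unitary_entry_bound[OF that])
  show ?thesis
  proof (rule integrable_const_bound[where B = 1])
    show "AE U in M. cmod (tensor n (\<lambda>_. U) i j * cnj (tensor n (\<lambda>_. U) i' j')) \<le> 1"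
    proof (rule AE_I2)
      fix U assume "U \<in> space M"
      then have "U \<in> unitary_group" by (simp add: haar_space)
      then have "cmod (tensor n (\<lambda>_. U) i j) * cmod (tensor n (\<lambda>_. U) i' j') \<le> 1 * 1"
        by (intro mult_mono bound) auto
      then show "cmod (tensor n (\<lambda>_. U) i j * cnj (tensor n (\<lambda>_. U) i' j')) \<le> 1"
        by (simp add: norm_mult)
    qed
    show "(\<lambda>U. tensor n (\<lambda>_. U) i j * cnj (tensor n (\<lambda>_. U) i' j')) \<in> borel_measurable M"
      by (intro haar_measurable continuous_intros continuous_on_tensor)
  qed
qed

text \<open>Invariance concerns the push-forward of \<open>M\<close>; turning it into a substitution
  needs left multiplication to be measurable into the unitary group, where closure under products
  enters.\<close>

lemma haar_left_invariant:
  fixes f :: "complex ^ 'N ^ 'N \<Rightarrow> complex"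
  assumes "V \<in> unitary_group" and "continuous_on UNIV f"
  shows "(LINT U|M. f (V ** U)) = (LINT U|M. f U)"
proof -
  have "(\<lambda>U. V ** U) \<in> measurable M (restrict_space borel unitary_group)"
  proof (rule measurable_restrict_space2)
    show "(\<lambda>U. V ** U) \<in> space M \<rightarrow> unitary_group"
      using unitary_group_mult[OF assms(1)] by (auto simp: haar_space)
    show "(\<lambda>U. V ** U) \<in> borel_measurable M"
      by (rule haar_measurable) (unfold matrix_matrix_mult_def, intro continuous_intros)
  qed
  then have meas: "(\<lambda>U. V ** U) \<in> measurable M M"
    by (simp add: measurable_cong_sets[OF refl haar_sets])
  have "(LINT U|M. f U) = (LINT U|distr M M (\<lambda>U. V ** U). f U)"
    using haar assms(1) by (simp add: haar_unitary_def)
  also have "\<dots> = (LINT U|M. f (V ** U))"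
    by (rule integral_distr[OF meas haar_measurable[OF assms(2)]])
  finally show ?thesis ..
qed

text \<open>Replacing \<open>U\<close> by \<open>V ** U\<close> and expanding both tensor powers
  conjugates the moment kernel by the tensor power of \<open>V\<close>.\<close>

lemma haar_moment_conjugate:
  assumes "V \<in> unitary_group"
  shows "haar_moment M n j j' i i' = (\<Sum>k\<in>tuples n. \<Sum>k'\<in>tuples n.
    tensor n (\<lambda>_. V) i k * cnj (tensor n (\<lambda>_. V) i' k') * haar_moment M n j j' k k')"
proof -
  let ?T = "\<lambda>U. tensor n (\<lambda>_. U) :: (nat \<Rightarrow> 'N) \<Rightarrow> (nat \<Rightarrow> 'N) \<Rightarrow> complex"
  have "haar_moment M n j j' i i' = (LINT U|M. ?T (V ** U) i j * cnj (?T (V ** U) i' j'))"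
    unfolding haar_moment_def
    by (rule haar_left_invariant[OF assms, symmetric]) (intro continuous_intros continuous_on_tensor)
  also have "\<dots> = (LINT U|M. (\<Sum>k\<in>tuples n. \<Sum>k'\<in>tuples n.
      (?T V i k * cnj (?T V i' k')) * (?T U k j * cnj (?T U k' j'))))"
    unfolding kernel_comp_tensor[symmetric] kernel_comp_def cnj_sum sum_product complex_cnj_mult
    by (simp only: mult_ac)
  also have "\<dots> = (\<Sum>k\<in>tuples n. \<Sum>k'\<in>tuples n. ?T V i k * cnj (?T V i' k') * haar_moment M n j j' k k')"
    unfolding haar_moment_def
    by (subst Bochner_Integration.integral_sum,
        intro Bochner_Integration.integrable_sum integrable_mult_right integrable_haar_tensor,
        intro sum.cong[OF refl], subst Bochner_Integration.integral_sum,
        intro integrable_mult_right integrable_haar_tensor,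
        intro sum.cong[OF refl] integral_mult_right_zero)
  finally show ?thesis .
qed

text \<open>The conjugation identity is multiplied on the right by the tensor power of
  \<open>V\<close>, whose columns are orthonormal, so the adjoint factor cancels.\<close>

lemma haar_moment_commutes:
  assumes "V \<in> unitary_group"
  shows "commutes_with n (haar_moment M n j j') (tensor n (\<lambda>_. V))"
  unfolding commutes_with_def
proof (intro ballI)
  fix i m :: "nat \<Rightarrow> 'N" assume "i \<in> tuples n" and m: "m \<in> tuples n"
  let ?T = "tensor n (\<lambda>_. V)"
  let ?W = "haar_moment M n j j'"
  have "kernel_comp n ?W ?T i m =
      (\<Sum>i'\<in>tuples n. (\<Sum>k\<in>tuples n. \<Sum>k'\<in>tuples n. ?T i k * cnj (?T i' k') * ?W k k') * ?T i' m)"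
    unfolding kernel_comp_def by (subst haar_moment_conjugate[OF assms]) (rule refl)
  also have "\<dots> = (\<Sum>i'\<in>tuples n. \<Sum>k\<in>tuples n. \<Sum>k'\<in>tuples n.
      ?T i k * ?W k k' * (cnj (?T i' k') * ?T i' m))"
    unfolding sum_distrib_right by (simp only: mult_ac)
  also have "\<dots> = (\<Sum>k\<in>tuples n. \<Sum>i'\<in>tuples n. \<Sum>k'\<in>tuples n.
      ?T i k * ?W k k' * (cnj (?T i' k') * ?T i' m))"
    by (rule sum.swap)
  also have "\<dots> = (\<Sum>k\<in>tuples n. \<Sum>k'\<in>tuples n. \<Sum>i'\<in>tuples n.
      ?T i k * ?W k k' * (cnj (?T i' k') * ?T i' m))"
    by (rule sum.cong[OF refl], rule sum.swap)
  also have "\<dots> = (\<Sum>k\<in>tuples n. \<Sum>k'\<in>tuples n. if k' = m then ?T i k * ?W k k' else 0)"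
  proof (intro sum.cong[OF refl])
    fix k k' :: "nat \<Rightarrow> 'N" assume k': "k' \<in> tuples n"
    show "(\<Sum>i'\<in>tuples n. ?T i k * ?W k k' * (cnj (?T i' k') * ?T i' m)) =
        (if k' = m then ?T i k * ?W k k' else 0)"
      unfolding sum_distrib_left[symmetric] tensor_unitary_orthonormal[OF assms k' m] by simp
  qed
  also have "\<dots> = kernel_comp n ?T ?W i m"
    unfolding kernel_comp_def sum.delta[OF finite_tuples] by (simp only: m if_True)
  finally show "kernel_comp n ?W ?T i m = kernel_comp n ?T ?W i m" .
qed

text \<open>Pairing with the tensor of \<open>\<tau>\<close> sets
  \<open>i = i' \<circ> \<tau>\<close> under the integral. Moving \<open>\<tau>\<close> over to the
  column index leaves an inner product of two columns, which is the same for every unitary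
  \<open>U\<close>.\<close>

lemma haar_moment_perm_tensor:
  assumes "\<tau> permutes {1..n}" and "j \<in> tuples n" and "j' \<in> tuples n"
  shows "(\<Sum>i\<in>tuples n. \<Sum>i'\<in>tuples n. perm_tensor n \<tau> i i' * haar_moment M n j j' i i') =
    perm_tensor n \<tau> j j'"
proof -
  interpret prob_space M using haar by (simp add: haar_unitary_def)
  let ?T = "\<lambda>U. tensor n (\<lambda>_. U) :: (nat \<Rightarrow> 'N) \<Rightarrow> (nat \<Rightarrow> 'N) \<Rightarrow> complex"
  have inv: "j \<circ> inv \<tau> \<in> tuples n" by (rule tuples_comp[OF assms(2) permutes_inv[OF assms(1)]])
  have "(\<Sum>i\<in>tuples n. \<Sum>i'\<in>tuples n. perm_tensor n \<tau> i i' * haar_moment M n j j' i i') =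
      (\<Sum>i'\<in>tuples n. \<Sum>i\<in>tuples n. perm_tensor n \<tau> i i' * haar_moment M n j j' i i')"
    by (rule sum.swap)
  also have "\<dots> = (\<Sum>i'\<in>tuples n. haar_moment M n j j' (i' \<circ> \<tau>) i')"
    by (intro sum.cong refl sum_perm_tensor_left assms(1))
  also have "\<dots> = (LINT U|M. (\<Sum>i'\<in>tuples n. ?T U (i' \<circ> \<tau>) j * cnj (?T U i' j')))"
    unfolding haar_moment_def
    by (rule Bochner_Integration.integral_sum[symmetric]) (rule integrable_haar_tensor)
  also have "\<dots> = (LINT U|M. of_bool (j' = j \<circ> inv \<tau>))"
  proof (rule Bochner_Integration.integral_cong[OF refl])
    fix U assume "U \<in> space M"
    then have U: "U \<in> unitary_group" by (simp add: haar_space)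
    show "(\<Sum>i'\<in>tuples n. ?T U (i' \<circ> \<tau>) j * cnj (?T U i' j')) = of_bool (j' = j \<circ> inv \<tau>)"
      unfolding tensor_permute[OF assms(1)] tensor_unitary_orthonormal[OF U assms(3) inv, symmetric]
      by (simp only: mult.commute)
  qed
  also have "\<dots> = of_bool (j' = j \<circ> inv \<tau>)" by (simp add: prob_space)
  also have "j' = j \<circ> inv \<tau> \<longleftrightarrow> j = j' \<circ> \<tau>"
    using permutes_inv_o[OF assms(1)] by (metis comp_assoc comp_id)
  also have "of_bool (j = j' \<circ> \<tau>) = perm_tensor n \<tau> j j'"
    by (rule perm_tensor_on_tuples[OF assms(2,3,1), symmetric])
  finally show ?thesis .
qed

text \<open>Duality supplies coefficients \<open>c\<close> without naming them; the pairings turn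
  them into the solution of a linear system with the Gram matrix, read off with its left
  inverse.\<close>

lemma haar_moment_eq:
  assumes "i \<in> tuples n" and "i' \<in> tuples n" and "j \<in> tuples n" and "j' \<in> tuples n"
  shows "haar_moment M n j j' i i' =
    (\<Sum>\<sigma>\<in>perms_no_decreasing CARD('N) n. \<Sum>\<tau>\<in>perms_no_decreasing CARD('N) n.
      perm_tensor n \<sigma> i i' * perm_tensor n \<tau> j j' *
      inverse_on (perms_no_decreasing CARD('N) n) (gram_matrix CARD('N) n) \<sigma> \<tau>)"
proof -
  let ?S = "perms_no_decreasing CARD('N) n"
  let ?G = "gram_matrix CARD('N) n"
  let ?B = "inverse_on ?S ?G"
  let ?X = "tuples n \<times> tuples n :: ((nat \<Rightarrow> 'N) \<times> (nat \<Rightarrow> 'N)) set"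
  let ?v = "\<lambda>\<sigma> (p :: (nat \<Rightarrow> 'N) \<times> (nat \<Rightarrow> 'N)). perm_tensor n \<sigma> (fst p) (snd p)"
  let ?W = "\<lambda>p. haar_moment M n j j' (fst p) (snd p)"
  note inv = is_inverse_onD[OF is_inverse_on_inverse_on[OF gram_matrix_invertible[where 'N='N, of n]]]
  obtain c where c: "\<And>i i'. i \<in> tuples n \<Longrightarrow> i' \<in> tuples n \<Longrightarrow>
      haar_moment M n j j' i i' = (\<Sum>\<sigma>\<in>?S. c \<sigma> * perm_tensor n \<sigma> i i')"
    using commutant_in_span[of n "haar_moment M n j j'", OF haar_moment_commutes] by blast
  have gram: "(\<Sum>\<sigma>\<in>?S. ?G \<tau> \<sigma> * c \<sigma>) = perm_tensor n \<tau> j j'" if "\<tau> \<in> ?S" for \<tau>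
  proof -
    have "perm_tensor n \<tau> j j' = (\<Sum>p\<in>?X. ?v \<tau> p * ?W p)"
      using haar_moment_perm_tensor[OF perms_no_decreasing_permutes[OF that] assms(3,4)]
      by (simp only: sum.cartesian_product case_prod_unfold)
    also have "\<dots> = (\<Sum>p\<in>?X. ?v \<tau> p * (\<Sum>\<sigma>\<in>?S. c \<sigma> * ?v \<sigma> p))"
      by (intro sum.cong refl) (simp only: c mem_Times_iff)
    also have "\<dots> = (\<Sum>\<sigma>\<in>?S. (\<Sum>p\<in>?X. ?v \<tau> p * ?v \<sigma> p) * c \<sigma>)"
      unfolding sum_distrib_left sum_distrib_right by (subst sum.swap) (simp only: mult_ac)
    also have "\<dots> = (\<Sum>\<sigma>\<in>?S. ?G \<tau> \<sigma> * c \<sigma>)"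
    proof (intro sum.cong refl)
      fix \<sigma> assume "\<sigma> \<in> ?S"
      then show "(\<Sum>p\<in>?X. ?v \<tau> p * ?v \<sigma> p) * c \<sigma> = ?G \<tau> \<sigma> * c \<sigma>"
        using perm_tensor_gram[where 'N='N, of \<tau> n \<sigma>] that perms_no_decreasing_permutes
        by (simp only: sum.cartesian_product case_prod_unfold)
    qed
    finally show ?thesis ..
  qed
  have coeff: "c \<sigma> = (\<Sum>\<tau>\<in>?S. ?B \<sigma> \<tau> * perm_tensor n \<tau> j j')" if \<sigma>: "\<sigma> \<in> ?S" for \<sigma>
  proof -
    have "(\<Sum>\<tau>\<in>?S. ?B \<sigma> \<tau> * perm_tensor n \<tau> j j') = (\<Sum>\<tau>\<in>?S. ?B \<sigma> \<tau> * (\<Sum>\<mu>\<in>?S. ?G \<tau> \<mu> * c \<mu>))"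
      by (intro sum.cong refl) (simp only: gram)
    also have "\<dots> = (\<Sum>\<mu>\<in>?S. (\<Sum>\<tau>\<in>?S. ?B \<sigma> \<tau> * ?G \<tau> \<mu>) * c \<mu>)"
      unfolding sum_distrib_left sum_distrib_right by (subst sum.swap) (simp only: mult_ac)
    also have "\<dots> = (\<Sum>\<mu>\<in>?S. if \<sigma> = \<mu> then c \<mu> else 0)"
      by (intro sum.cong refl) (simp add: inv(2)[OF \<sigma>])
    also have "\<dots> = c \<sigma>" using \<sigma> finite_perms_no_decreasing by simp
    finally show ?thesis ..
  qed
  have "haar_moment M n j j' i i' =
      (\<Sum>\<sigma>\<in>?S. (\<Sum>\<tau>\<in>?S. ?B \<sigma> \<tau> * perm_tensor n \<tau> j j') * perm_tensor n \<sigma> i i')"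
    unfolding c[OF assms(1,2)] by (intro sum.cong refl) (simp only: coeff)
  then show ?thesis unfolding sum_distrib_right by (simp only: mult_ac)
qed

end

theorem theorem3p1:
  fixes n :: nat
  assumes "n \<ge> 1"
  shows "invertible_on (perms_no_decreasing CARD('N::finite) n) (gram_matrix CARD('N) n) \<and>
    (\<forall>(M :: (complex ^ 'N ^ 'N) measure) (i :: nat \<Rightarrow> 'N) (j :: nat \<Rightarrow> 'N)
        (i' :: nat \<Rightarrow> 'N) (j' :: nat \<Rightarrow> 'N).
      haar_unitary M \<longrightarrow>
      (LINT U|M. (\<Prod>k=1..n. U $ i k $ j k * cnj (U $ i' k $ j' k))) =
      (\<Sum>\<sigma>\<in>perms_no_decreasing CARD('N) n. \<Sum>\<tau>\<in>perms_no_decreasing CARD('N) n.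
         of_bool (\<forall>k\<in>{1..n}. i k = (i' \<circ> \<sigma>) k) * of_bool (\<forall>k\<in>{1..n}. j k = (j' \<circ> \<tau>) k) *
         inverse_on (perms_no_decreasing CARD('N) n) (gram_matrix CARD('N) n) \<sigma> \<tau>))"
proof (intro conjI allI impI gram_matrix_invertible)
  fix M :: "(complex ^ 'N ^ 'N) measure" and i j i' j' :: "nat \<Rightarrow> 'N"
  assume haar: "haar_unitary M"
  let ?S = "perms_no_decreasing CARD('N) n"
  let ?B = "inverse_on ?S (gram_matrix CARD('N) n)"
  \<comment> \<open>Arbitrary functions are cut down to tuples. Nothing changes: the integrand sees
    only \<open>{1..n}\<close>, and every \<open>\<sigma>\<close> maps \<open>{1..n}\<close> to
    itself.\<close>
  let ?r = "\<lambda>f :: nat \<Rightarrow> 'N. restrict f {1..n}"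
  have r: "?r f \<in> tuples n" for f by simp
  have perm: "perm_tensor n \<sigma> (?r f) (?r f') = of_bool (\<forall>k\<in>{1..n}. f k = (f' \<circ> \<sigma>) k)"
    if "\<sigma> \<in> ?S" for \<sigma> f f'
  proof -
    have "(\<forall>k\<in>{1..n}. ?r f k = ?r f' (\<sigma> k)) \<longleftrightarrow> (\<forall>k\<in>{1..n}. f k = (f' \<circ> \<sigma>) k)"
      using permutes_in_image[OF perms_no_decreasing_permutes[OF that]]
      by (intro ball_cong refl) (simp only: restrict_def o_def if_True)
    then show ?thesis by (simp only: perm_tensor_def)
  qed
  have "(LINT U|M. (\<Prod>k=1..n. U $ i k $ j k * cnj (U $ i' k $ j' k))) =
      haar_moment M n (?r j) (?r j') (?r i) (?r i')"
    unfolding haar_moment_def tensor_def by (simp add: prod.distrib)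
  also have "\<dots> = (\<Sum>\<sigma>\<in>?S. \<Sum>\<tau>\<in>?S.
      perm_tensor n \<sigma> (?r i) (?r i') * perm_tensor n \<tau> (?r j) (?r j') * ?B \<sigma> \<tau>)"
    by (rule haar_moment_eq[OF haar r r r r])
  also have "\<dots> = (\<Sum>\<sigma>\<in>?S. \<Sum>\<tau>\<in>?S.
      of_bool (\<forall>k\<in>{1..n}. i k = (i' \<circ> \<sigma>) k) * of_bool (\<forall>k\<in>{1..n}. j k = (j' \<circ> \<tau>) k) * ?B \<sigma> \<tau>)"
    by (intro sum.cong refl) (simp only: perm)
  finally show "(LINT U|M. (\<Prod>k=1..n. U $ i k $ j k * cnj (U $ i' k $ j' k))) =
      (\<Sum>\<sigma>\<in>?S. \<Sum>\<tau>\<in>?S.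
      of_bool (\<forall>k\<in>{1..n}. i k = (i' \<circ> \<sigma>) k) * of_bool (\<forall>k\<in>{1..n}. j k = (j' \<circ> \<tau>) k) * ?B \<sigma> \<tau>)" .
qed

end
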